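(* Let $\mathscr{H}_1$ and $\mathscr{H}_2$ be infinite-dimensional complex Hilbert spaces, let $D_1 \in \mathscr{B}(\mathscr{H}_1)$ and $D_2 \in \mathscr{B}(\mathscr{H}_2)$ be fixed operators, and let $\Psi : \mathscr{B}(\mathscr{H}_1) \to \mathscr{B}(\mathscr{H}_2)$ be a bijective linear map such that $$\Psi(A_1) \circ \Psi(A_2) = D_2 \quad \text{whenever} \quad A_1 \circ A_2 = D_1$$ for all $A_1, A_2 \in \mathscr{B}(\mathscr{H}_1)$. Fix an arbitrary orthonormal basis of $\mathscr{H}_1$, and for $A \in \mathscr{B}(\mathscr{H}_1)$ let $A^\star$ denote the transpose of $A$ relative to this basis. Then there exist a non-zero scalar $c \in \mathbb{C}$ and an invertible operator $U \in \mathscr{B}(\mathscr{H}_1, \mathscr{H}_2)$ such that either $\Psi(A_1) = c\,U A_1 U^{-1}$ for all $A_1 \in \mathscr{B}(\mathscr{H}_1)$, or $\Psi(A_1) = c\,U A_1^\star U^{-1}$ for all $A_1 \in \mathscr{B}(\mathscr{H}_1)$.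
   Context: $\mathscr{B}(\mathscr{H})$ denotes the algebra of bounded linear operators on the Hilbert space $\mathscr{H}$, and $\mathscr{B}(\mathscr{H}_1, \mathscr{H}_2)$ the space of bounded linear operators from $\mathscr{H}_1$ to $\mathscr{H}_2$. The symbol $\circ$ denotes the Jordan product $A_1 \circ A_2 = A_1A_2 + A_2A_1$ (not composition). The transpose $A^\star$ of $A$ relative to an orthonormal basis $(e_i)$ of $\mathscr{H}_1$ is the bounded operator (depending linearly on $A$; not the Hilbert-space adjoint) with $\langle A^\star e_i, e_j\rangle = \langle A e_j, e_i\rangle$ for all $i, j$. *)

theory Defs
  imports "HOL-Analysis.Analysis"
begin

class complex_vector = real_vector +
  fixes scaleC :: "complex \<Rightarrow> 'a \<Rightarrow> 'a" (infixr "*\<^sub>C" 75)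
  assumes scaleC_add_right: "c *\<^sub>C (x + y) = c *\<^sub>C x + c *\<^sub>C y"
    and scaleC_add_left: "(c + d) *\<^sub>C x = c *\<^sub>C x + d *\<^sub>C x"
    and scaleC_scaleC: "c *\<^sub>C d *\<^sub>C x = (c * d) *\<^sub>C x"
    and scaleC_one: "1 *\<^sub>C x = x"
    and scaleC_of_real: "complex_of_real r *\<^sub>C x = r *\<^sub>R x"

global_interpretation complex_vector: vector_space "scaleC :: complex \<Rightarrow> 'a \<Rightarrow> 'a::complex_vector"
  defines cspan_raw_def: cspan = complex_vector.span
  by unfold_locales (simp_all add: scaleC_add_right scaleC_add_left scaleC_scaleC scaleC_one)

abbreviation clinear :: "('a::complex_vector \<Rightarrow> 'b::complex_vector) \<Rightarrow> bool"
  where "clinear \<equiv> Vector_Spaces.linear scaleC scaleC"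

lemma clinear_iff:
  "clinear f \<longleftrightarrow> (\<forall>x y. f (x + y) = f x + f y) \<and> (\<forall>c x. f (c *\<^sub>C x) = c *\<^sub>C f x)"
  unfolding Vector_Spaces.linear_def module_hom_def module_hom_axioms_def
  by (auto intro: complex_vector.vector_space_axioms complex_vector.module_axioms)

text \<open>
  A complex inner product, linear in the first argument, whose real part is the inner product
  of the underlying real inner product space.  Positive definiteness and
  \<open>norm x = sqrt (Re (cinner x x))\<close> are inherited from \<^class>\<open>real_inner\<close>.
\<close>

class complex_inner = complex_vector + real_inner +
  fixes cinner :: "'a \<Rightarrow> 'a \<Rightarrow> complex"
  assumes cinner_commute: "cinner x y = cnj (cinner y x)"
    and cinner_add_left: "cinner (x + y) z = cinner x z + cinner y z"
    and cinner_scaleC_left: "cinner (c *\<^sub>C x) y = c * cinner x y"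
    and Re_cinner: "Re (cinner x y) = inner x y"

class chilbert_space = complex_inner + complete_space

lemma norm_scaleC: "norm (c *\<^sub>C x) = cmod c * norm (x :: 'a::complex_inner)"
proof -
  have im: "Im (cinner x x) = 0"
    by (metis Reals_cnj_iff cinner_commute complex_is_Real_iff)
  have "cinner (c *\<^sub>C x) (c *\<^sub>C x) = c * cnj c * cinner x x"
    by (metis ab_semigroup_mult_class.mult_ac(1) cinner_commute cinner_scaleC_left complex_cnj_mult)
  also have "\<dots> = complex_of_real ((cmod c)\<^sup>2) * cinner x x"
    by (simp only: complex_norm_square)
  finally have "inner (c *\<^sub>C x) (c *\<^sub>C x) = (cmod c)\<^sup>2 * inner x x"
    by (simp add: Re_cinner[symmetric] im)
  then show ?thesis
    by (simp add: norm_eq_sqrt_inner real_sqrt_mult)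
qed

definition bounded_clinear :: "('a::complex_inner \<Rightarrow> 'b::complex_inner) \<Rightarrow> bool"
  where "bounded_clinear f \<longleftrightarrow> clinear f \<and> (\<exists>K. \<forall>x. norm (f x) \<le> K * norm x)"

lemma bounded_clinearI:
  assumes "\<And>x y. f (x + y) = f x + f y" "\<And>c x. f (c *\<^sub>C x) = c *\<^sub>C f x"
    "\<And>x. norm (f x) \<le> K * norm x"
  shows "bounded_clinear f"
  using assms unfolding bounded_clinear_def clinear_iff by blast

lemma bounded_clinearD:
  assumes "bounded_clinear f"
  shows "\<exists>K. (\<forall>x y. f (x + y) = f x + f y) \<and> (\<forall>c x. f (c *\<^sub>C x) = c *\<^sub>C f x) \<and>
    0 \<le> K \<and> (\<forall>x. norm (f x) \<le> K * norm x)"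
proof -
  obtain K where K: "\<And>x. norm (f x) \<le> K * norm x"
    using assms unfolding bounded_clinear_def by blast
  have "norm (f x) \<le> \<bar>K\<bar> * norm x" for x
    using K[of x] by (meson abs_ge_self mult_right_mono norm_ge_zero order_trans)
  then show ?thesis
    using assms unfolding bounded_clinear_def clinear_iff by (intro exI[of _ "\<bar>K\<bar>"]) simp
qed

typedef (overloaded) ('a, 'b) cblinfun =
  "{f :: 'a::complex_inner \<Rightarrow> 'b::complex_inner. bounded_clinear f}"
  morphisms cblinfun_apply CBlinfun
proof -
  have "bounded_clinear (\<lambda>x :: 'a. 0 :: 'b)"
    by (rule bounded_clinearI[where K = 0]) simp_all
  then show ?thesis by blast
qed

setup_lifting type_definition_cblinfun

instantiation cblinfun :: (complex_inner, complex_inner) complex_vector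
begin

lift_definition zero_cblinfun :: "('a, 'b) cblinfun" is "\<lambda>x. 0"
  by (rule bounded_clinearI[where K = 0]) simp_all

lift_definition plus_cblinfun :: "('a, 'b) cblinfun \<Rightarrow> ('a, 'b) cblinfun \<Rightarrow> ('a, 'b) cblinfun"
  is "\<lambda>f g x. f x + g x"
proof -
  fix f g :: "'a \<Rightarrow> 'b"
  assume "bounded_clinear f" "bounded_clinear g"
  from \<open>bounded_clinear f\<close> obtain K where f: "\<And>x y. f (x + y) = f x + f y"
      "\<And>c x. f (c *\<^sub>C x) = c *\<^sub>C f x" "K \<ge> 0" "\<And>x. norm (f x) \<le> K * norm x"
    by (blast dest: bounded_clinearD)
  from \<open>bounded_clinear g\<close> obtain L where g: "\<And>x y. g (x + y) = g x + g y"
      "\<And>c x. g (c *\<^sub>C x) = c *\<^sub>C g x" "L \<ge> 0" "\<And>x. norm (g x) \<le> L * norm x"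
    by (blast dest: bounded_clinearD)
  have "norm (f x + g x) \<le> (K + L) * norm x" for x
    using norm_triangle_ineq[of "f x" "g x"] f(4)[of x] g(4)[of x] by (simp add: distrib_right)
  then show "bounded_clinear (\<lambda>x. f x + g x)"
    by (intro bounded_clinearI[where K = "K + L"]) (simp_all add: f g scaleC_add_right)
qed

lift_definition scaleC_cblinfun :: "complex \<Rightarrow> ('a, 'b) cblinfun \<Rightarrow> ('a, 'b) cblinfun"
  is "\<lambda>c f x. c *\<^sub>C f x"
proof -
  fix c :: complex and f :: "'a \<Rightarrow> 'b"
  assume "bounded_clinear f"
  from \<open>bounded_clinear f\<close> obtain K where f: "\<And>x y. f (x + y) = f x + f y"
      "\<And>c x. f (c *\<^sub>C x) = c *\<^sub>C f x" "K \<ge> 0" "\<And>x. norm (f x) \<le> K * norm x"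
    by (blast dest: bounded_clinearD)
  have "norm (c *\<^sub>C f x) \<le> (cmod c * K) * norm x" for x
    using mult_left_mono[OF f(4)[of x], of "cmod c"] by (simp add: norm_scaleC mult.assoc)
  then show "bounded_clinear (\<lambda>x. c *\<^sub>C f x)"
    by (intro bounded_clinearI[where K = "cmod c * K"])
      (simp_all add: f scaleC_add_right scaleC_scaleC mult.commute)
qed

definition scaleR_cblinfun :: "real \<Rightarrow> ('a, 'b) cblinfun \<Rightarrow> ('a, 'b) cblinfun"
  where "scaleR_cblinfun r A = complex_of_real r *\<^sub>C A"

definition uminus_cblinfun :: "('a, 'b) cblinfun \<Rightarrow> ('a, 'b) cblinfun"
  where "uminus_cblinfun A = (- 1) *\<^sub>C A"

definition minus_cblinfun :: "('a, 'b) cblinfun \<Rightarrow> ('a, 'b) cblinfun \<Rightarrow> ('a, 'b) cblinfun"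
  where "minus_cblinfun A B = A + (- B)"

instance
proof
  fix A B C :: "('a, 'b) cblinfun" and c d :: complex and r s :: real
  show "A + B + C = A + (B + C)" by transfer (simp add: add.assoc)
  show "A + B = B + A" by transfer (simp add: add.commute)
  show "0 + A = A" by transfer simp
  show neg: "- A + A = 0"
    unfolding uminus_cblinfun_def by transfer simp
  show "A - B = A + - B" by (rule minus_cblinfun_def)
  show add_r: "c *\<^sub>C (A + B) = c *\<^sub>C A + c *\<^sub>C B" for c and A B :: "('a, 'b) cblinfun"
    by transfer (simp add: scaleC_add_right)
  show add_l: "(c + d) *\<^sub>C A = c *\<^sub>C A + d *\<^sub>C A" for c d and A :: "('a, 'b) cblinfun"
    by transfer (simp add: scaleC_add_left)
  show mul: "c *\<^sub>C d *\<^sub>C A = (c * d) *\<^sub>C A" for c d and A :: "('a, 'b) cblinfun"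
    by transfer (simp add: scaleC_scaleC)
  show one: "1 *\<^sub>C A = A" for A :: "('a, 'b) cblinfun"
    by transfer (simp add: scaleC_one)
  show "r *\<^sub>R (A + B) = r *\<^sub>R A + r *\<^sub>R B" by (simp add: scaleR_cblinfun_def add_r)
  show "(r + s) *\<^sub>R A = r *\<^sub>R A + s *\<^sub>R A" by (simp add: scaleR_cblinfun_def add_l)
  show "r *\<^sub>R s *\<^sub>R A = (r * s) *\<^sub>R A" by (simp add: scaleR_cblinfun_def mul)
  show "1 *\<^sub>R A = A" by (simp add: scaleR_cblinfun_def one)
  show "complex_of_real r *\<^sub>C A = r *\<^sub>R A" by (simp add: scaleR_cblinfun_def)
qed

end

lift_definition cblinfun_id :: "('a::complex_inner, 'a) cblinfun" is "\<lambda>x. x"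
  by (rule bounded_clinearI[where K = 1]) simp_all

lift_definition cblinfun_compose ::
    "('b::complex_inner, 'c::complex_inner) cblinfun \<Rightarrow> ('a::complex_inner, 'b) cblinfun
      \<Rightarrow> ('a, 'c) cblinfun" (infixl "o\<^sub>C" 67)
  is "\<lambda>f g x. f (g x)"
proof -
  fix f :: "'b \<Rightarrow> 'c" and g :: "'a \<Rightarrow> 'b"
  assume "bounded_clinear f" "bounded_clinear g"
  from \<open>bounded_clinear f\<close> obtain K where f: "\<And>x y. f (x + y) = f x + f y"
      "\<And>c x. f (c *\<^sub>C x) = c *\<^sub>C f x" "K \<ge> 0" "\<And>x. norm (f x) \<le> K * norm x"
    by (blast dest: bounded_clinearD)
  from \<open>bounded_clinear g\<close> obtain L where g: "\<And>x y. g (x + y) = g x + g y"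
      "\<And>c x. g (c *\<^sub>C x) = c *\<^sub>C g x" "L \<ge> 0" "\<And>x. norm (g x) \<le> L * norm x"
    by (blast dest: bounded_clinearD)
  have "norm (f (g x)) \<le> (K * L) * norm x" for x
    using f(4)[of "g x"] mult_left_mono[OF g(4)[of x] f(3)] by (simp add: mult.assoc)
  then show "bounded_clinear (\<lambda>x. f (g x))"
    by (intro bounded_clinearI[where K = "K * L"]) (simp_all add: f g)
qed

definition jordan_product ::
    "('a::complex_inner, 'a) cblinfun \<Rightarrow> ('a, 'a) cblinfun \<Rightarrow> ('a, 'a) cblinfun"
    (infixl "\<circ>\<^sub>J" 67)
  where "A \<circ>\<^sub>J B = A o\<^sub>C B + B o\<^sub>C A"

definition orthonormal_basis :: "('i \<Rightarrow> 'a::complex_inner) \<Rightarrow> bool"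
  where "orthonormal_basis e \<longleftrightarrow>
    (\<forall>i j. cinner (e i) (e j) = (if i = j then 1 else 0)) \<and> closure (cspan (range e)) = UNIV"

text \<open>
  The description is proper for an orthonormal basis \<open>e\<close> of a Hilbert space: the matrix
  coefficients determine a bounded operator, and the transpose exists as
  \<open>J A\<^sup>\<dagger> J\<close>, where \<open>J\<close> is the conjugation fixing every \<open>e i\<close>
  and \<open>A\<^sup>\<dagger>\<close> the adjoint of \<open>A\<close>.
\<close>

definition op_transpose ::
    "('i \<Rightarrow> 'a::complex_inner) \<Rightarrow> ('a, 'a) cblinfun \<Rightarrow> ('a, 'a) cblinfun"
  where "op_transpose e A = (THE B. \<forall>i j.
    cinner (cblinfun_apply B (e i)) (e j) = cinner (cblinfun_apply A (e j)) (e i))"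

end

theory Submission
  imports Defs
begin

text \<open>
  Put \<open>Z = \<Psi> 1\<close>. The bilinear map \<open>2 \<Psi> A \<circ> \<Psi> B - Z \<circ> \<Psi> (A \<circ> B)\<close> is symmetric, vanishes
  when \<open>A = 1\<close>, and vanishes when \<open>A \<circ> B = D\<^sub>1\<close> (compare with the pair \<open>(1/2, D\<^sub>1)\<close>).
  If \<open>D\<^sub>1 \<noteq> 0\<close>, take a rank-one projection \<open>Q\<close> with \<open>Q D\<^sub>1 Q \<noteq> 0\<close>: the solution \<open>X\<close> of
  \<open>(a Q + (1 - Q) + B) \<circ> X = D\<^sub>1\<close> has a pole along \<open>Q\<close> at \<open>a = 0\<close>, and if \<open>B\<close> is chosen so that
  the off-diagonal part of \<open>X\<close> is an explicit rational function of \<open>a\<close>, the residue shows that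
  the form vanishes at \<open>(B, Q)\<close>; no continuity of \<open>\<Psi>\<close> is needed. A density argument then gives
  \<open>2 \<Psi> B \<circ> \<Psi> F = Z \<circ> \<Psi> (B \<circ> F)\<close> for all \<open>B\<close> and all \<open>F\<close> of finite rank.

  From this identity and surjectivity, \<open>Z\<^sup>2\<close> and then \<open>Z\<close> commute with the images of finite-rank
  operators, which forces \<open>Z\<close> to be a non-zero scalar. After normalization \<open>\<Psi>\<close> maps rank-one
  projections to rank-one idempotents; looking at the Peirce corners of one of them shows
  that the map, or its composition with the transpose, is implemented by the linear bijection
  \<open>U y = \<Psi> (y \<otimes> x) u\<close>, which is bounded because it is weakly bounded.
\<close>

instance chilbert_space \<subseteq> banach ..

section \<open>Complex inner products\<close>

lemma cinner_scaleC_right: "cinner x (c *\<^sub>C y) = cnj c * cinner x y"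
  by (metis cinner_commute cinner_scaleC_left complex_cnj_mult)

lemma cinner_add_right: "cinner x (y + z) = cinner x y + cinner x z"
  by (metis cinner_add_left cinner_commute complex_cnj_add)

lemma cinner_zero_left [simp]: "cinner 0 x = 0"
  using cinner_add_left[of 0 0 x] by simp

lemma cinner_zero_right [simp]: "cinner x 0 = 0"
  using cinner_add_right[of x 0 0] by simp

lemma cinner_minus_left: "cinner (- x) y = - cinner x y"
  using cinner_add_left[of x "- x" y] by (simp add: eq_neg_iff_add_eq_0 add.commute)

lemma cinner_minus_right: "cinner x (- y) = - cinner x y"
  using cinner_add_right[of x y "- y"] by (simp add: eq_neg_iff_add_eq_0 add.commute)

lemma cinner_diff_left: "cinner (x - y) z = cinner x z - cinner y z"
  using cinner_add_left[of x "- y" z] by (simp add: cinner_minus_left)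

lemma cinner_diff_right: "cinner x (y - z) = cinner x y - cinner x z"
  using cinner_add_right[of x y "- z"] by (simp add: cinner_minus_right)

lemmas cinner_simps = cinner_add_left cinner_add_right cinner_minus_left cinner_minus_right
  cinner_diff_left cinner_diff_right cinner_scaleC_left cinner_scaleC_right

lemma cinner_self: "cinner x x = complex_of_real ((norm x)\<^sup>2)"
proof (rule complex_eqI)
  have "Im (cinner x x) = - Im (cinner x x)"
    by (metis cinner_commute cnj.simps(2))
  then show "Im (cinner x x) = Im (complex_of_real ((norm x)\<^sup>2))" by simp
qed (simp add: Re_cinner power2_norm_eq_inner)

lemma cinner_self_eq_0_iff [simp]: "cinner x x = 0 \<longleftrightarrow> x = 0"
  by (simp add: cinner_self)

lemma cinner_eq_0_sym: "cinner x y = 0 \<longleftrightarrow> cinner y x = 0"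
  by (metis cinner_commute complex_cnj_zero_iff)

lemma cinner_ext_left: "(\<And>y. cinner x y = cinner x' y) \<Longrightarrow> x = x'"
  using cinner_self_eq_0_iff[of "x - x'"] by (simp add: cinner_diff_left del: cinner_self_eq_0_iff)

lemma cinner_ext_right: "(\<And>x. cinner x y = cinner x y') \<Longrightarrow> y = y'"
  using cinner_self_eq_0_iff[of "y - y'"] by (simp add: cinner_diff_right del: cinner_self_eq_0_iff)

text \<open>Rotating \<open>x\<close> by a unimodular scalar makes the complex inner product real
  and positive, so the real Cauchy-Schwarz inequality applies.\<close>

lemma cmod_cinner_le: "cmod (cinner x y) \<le> norm x * norm y"
proof (cases "cinner x y = 0")
  case False
  define c where "c = cnj (cinner x y) / cmod (cinner x y)"
  have c: "cmod c = 1" using False by (simp add: c_def norm_divide)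
  have "c * cinner x y = cmod (cinner x y)"
    using False complex_norm_square[of "cinner x y"]
    by (simp add: c_def field_simps power2_eq_square)
  then have "cmod (cinner x y) = inner (c *\<^sub>C x) y"
    by (metis Re_cinner Re_complex_of_real cinner_scaleC_left)
  also have "\<dots> \<le> norm x * norm y"
    using norm_cauchy_schwarz[of "c *\<^sub>C x" y] by (simp add: norm_scaleC c)
  finally show ?thesis .
qed simp

lemma bounded_linear_cinner_left: "bounded_linear (\<lambda>x. cinner x y)"
proof (rule bounded_linear_intro)
  show "cinner (r *\<^sub>R x) y = r *\<^sub>R cinner x y" for r x
    by (metis cinner_scaleC_left scaleC_of_real scaleR_conv_of_real)
  show "norm (cinner x y) \<le> norm x * norm y" for x
    by (rule cmod_cinner_le)
qed (rule cinner_add_left)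

lemma tendsto_cinner_left: "(f \<longlongrightarrow> l) F \<Longrightarrow> ((\<lambda>n. cinner (f n) y) \<longlongrightarrow> cinner l y) F"
  by (rule bounded_linear.tendsto[OF bounded_linear_cinner_left])

lemma tendsto_cinner_right: "(f \<longlongrightarrow> l) F \<Longrightarrow> ((\<lambda>n. cinner y (f n)) \<longlongrightarrow> cinner y l) F"
  using tendsto_cnj[OF tendsto_cinner_left, of f l F y] by (simp flip: cinner_commute)

lemma norm_le_if_cinner_le:
  assumes "0 \<le> M" "\<And>y. cmod (cinner x y) \<le> M * norm y"
  shows "norm x \<le> M"
proof (cases "x = 0")
  case False
  have "norm x * norm x \<le> M * norm x"
    using assms(2)[of x] by (simp add: cinner_self norm_mult power2_eq_square)
  with False show ?thesis by simp
qed (use assms in simp)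

section \<open>Bounded operators\<close>

lemma cblinfun_eqI: "(\<And>x. cblinfun_apply A x = cblinfun_apply B x) \<Longrightarrow> A = B"
  by (metis cblinfun_apply_inject ext)

lemma cblinfun_eq_cinnerI:
  "(\<And>x y. cinner (cblinfun_apply A x) y = cinner (cblinfun_apply B x) y) \<Longrightarrow> A = B"
  by (rule cblinfun_eqI, rule cinner_ext_left)

lemma bounded_clinear_apply: "bounded_clinear (cblinfun_apply A)"
  using cblinfun_apply by blast

lemma CBlinfun_apply: "bounded_clinear f \<Longrightarrow> cblinfun_apply (CBlinfun f) x = f x"
  by (simp add: CBlinfun_inverse)

lemma cblinfun_bound: "\<exists>K\<ge>0. \<forall>x. norm (cblinfun_apply A x) \<le> K * norm x"
  using bounded_clinearD[OF bounded_clinear_apply] by blast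

lemma apply_add: "cblinfun_apply A (x + y) = cblinfun_apply A x + cblinfun_apply A y"
  and apply_scaleC: "cblinfun_apply A (c *\<^sub>C x) = c *\<^sub>C cblinfun_apply A x"
  using bounded_clinearD[OF bounded_clinear_apply] by blast+

lemma apply_scaleR: "cblinfun_apply A (r *\<^sub>R x) = r *\<^sub>R cblinfun_apply A x"
  by (metis apply_scaleC scaleC_of_real)

lemma apply_zero [simp]: "cblinfun_apply A 0 = 0"
  using apply_add[of A 0 0] by simp

lemma apply_minus: "cblinfun_apply A (- x) = - cblinfun_apply A x"
  using apply_add[of A x "- x"] by (simp add: eq_neg_iff_add_eq_0 add.commute)

lemma apply_diff: "cblinfun_apply A (x - y) = cblinfun_apply A x - cblinfun_apply A y"
  using apply_add[of A x "- y"] by (simp add: apply_minus)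

lemma scaleC_minus1: "(- 1) *\<^sub>C x = - x"
  by (metis complex_vector.scale_minus_left scaleC_one)

lemma minus_apply: "cblinfun_apply (- A) x = - cblinfun_apply A x"
  unfolding uminus_cblinfun_def scaleC_cblinfun.rep_eq by (rule scaleC_minus1)

lemma diff_apply: "cblinfun_apply (A - B) x = cblinfun_apply A x - cblinfun_apply B x"
  unfolding minus_cblinfun_def plus_cblinfun.rep_eq minus_apply by simp

lemma scaleR_apply: "cblinfun_apply (r *\<^sub>R A) x = r *\<^sub>R cblinfun_apply A x"
  by (metis scaleC_cblinfun.rep_eq scaleC_of_real)

lemma jordan_apply: "cblinfun_apply (A \<circ>\<^sub>J B) x =
    cblinfun_apply A (cblinfun_apply B x) + cblinfun_apply B (cblinfun_apply A x)"
  by (simp add: jordan_product_def plus_cblinfun.rep_eq cblinfun_compose.rep_eq)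

lemmas op_apply = plus_cblinfun.rep_eq scaleC_cblinfun.rep_eq zero_cblinfun.rep_eq
  minus_apply diff_apply cblinfun_compose.rep_eq cblinfun_id.rep_eq jordan_apply scaleR_apply
  apply_add apply_scaleC apply_minus apply_diff apply_scaleR

lemmas scaleC_simps = scaleC_add_right scaleC_add_left scaleC_scaleC scaleC_one
  complex_vector.scale_right_diff_distrib complex_vector.scale_left_diff_distrib

lemma bounded_linear_apply: "bounded_linear (cblinfun_apply A)"
proof -
  obtain K where "\<And>x. norm (cblinfun_apply A x) \<le> K * norm x"
    using cblinfun_bound by blast
  then show ?thesis
    by (intro bounded_linear_intro[of _ K]) (simp_all add: op_apply mult.commute)
qed

lemma compose_assoc: "A o\<^sub>C B o\<^sub>C C = A o\<^sub>C (B o\<^sub>C C)"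
  and compose_add_left: "(A + B) o\<^sub>C C = A o\<^sub>C C + B o\<^sub>C C"
  and compose_diff_left: "(A - B) o\<^sub>C C = A o\<^sub>C C - B o\<^sub>C C"
  and compose_minus_left: "(- A) o\<^sub>C C = - (A o\<^sub>C C)"
  and compose_scaleC_left: "(c *\<^sub>C A) o\<^sub>C C = c *\<^sub>C (A o\<^sub>C C)"
  and compose_zero_left: "0 o\<^sub>C C = 0"
  and compose_id_left: "cblinfun_id o\<^sub>C C = C"
  by (rule cblinfun_eqI; simp add: op_apply)+

lemma compose_add_right: "A o\<^sub>C (B + C) = A o\<^sub>C B + A o\<^sub>C C"
  and compose_diff_right: "A o\<^sub>C (B - C) = A o\<^sub>C B - A o\<^sub>C C"
  and compose_minus_right: "A o\<^sub>C (- C) = - (A o\<^sub>C C)"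
  and compose_scaleC_right: "A o\<^sub>C (c *\<^sub>C C) = c *\<^sub>C (A o\<^sub>C C)"
  and compose_zero_right: "A o\<^sub>C 0 = 0"
  and compose_id_right: "A o\<^sub>C cblinfun_id = A"
  by (rule cblinfun_eqI; simp add: op_apply)+

lemmas compose_simps = compose_assoc compose_add_left compose_add_right compose_diff_left
  compose_diff_right compose_minus_left compose_minus_right compose_scaleC_left
  compose_scaleC_right compose_zero_left compose_zero_right compose_id_left compose_id_right

lemma jordan_commute: "A \<circ>\<^sub>J B = B \<circ>\<^sub>J A"
  by (simp add: jordan_product_def add.commute)

lemma jordan_add_left: "(A + B) \<circ>\<^sub>J C = A \<circ>\<^sub>J C + B \<circ>\<^sub>J C"
  and jordan_diff_left: "(A - B) \<circ>\<^sub>J C = A \<circ>\<^sub>J C - B \<circ>\<^sub>J C"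
  and jordan_scaleC_left: "(c *\<^sub>C A) \<circ>\<^sub>J C = c *\<^sub>C (A \<circ>\<^sub>J C)"
  and jordan_zero_left: "0 \<circ>\<^sub>J C = 0"
  and jordan_id_left: "cblinfun_id \<circ>\<^sub>J C = C + C"
  by (simp_all add: jordan_product_def compose_simps scaleC_add_right)

lemma jordan_add_right: "A \<circ>\<^sub>J (B + C) = A \<circ>\<^sub>J B + A \<circ>\<^sub>J C"
  and jordan_diff_right: "A \<circ>\<^sub>J (B - C) = A \<circ>\<^sub>J B - A \<circ>\<^sub>J C"
  and jordan_scaleC_right: "A \<circ>\<^sub>J (c *\<^sub>C C) = c *\<^sub>C (A \<circ>\<^sub>J C)"
  and jordan_zero_right: "A \<circ>\<^sub>J 0 = 0"
  and jordan_id_right: "A \<circ>\<^sub>J cblinfun_id = A + A"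
  by (simp_all add: jordan_product_def compose_simps scaleC_add_right)

lemmas jordan_simps = jordan_add_left jordan_diff_left jordan_scaleC_left jordan_zero_left
  jordan_id_left jordan_add_right jordan_diff_right jordan_scaleC_right jordan_zero_right
  jordan_id_right

section \<open>Riesz representation and adjoints\<close>

text \<open>The representing vector is a multiple of the point \<open>z\<close> of least norm on the
  affine hyperplane where \<open>f\<close> equals 1; minimality makes \<open>z\<close> orthogonal to
  the kernel of \<open>f\<close>.\<close>

lemma riesz_real:
  fixes f :: "'a::{real_inner,complete_space} \<Rightarrow> real"
  assumes f: "bounded_linear f"
  shows "\<exists>y. \<forall>x. f x = inner y x"
proof (cases "\<forall>x. f x = 0")
  case True
  then show ?thesis by (intro exI[of _ 0]) simp
next
  case False
  interpret bounded_linear f by fact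
  from False obtain x0 where x0: "f x0 \<noteq> 0" by blast
  define K where "K = {x. f x = 1}"
  have "f (x0 /\<^sub>R f x0) = 1" using x0 by (simp add: scaleR)
  then have K_ne: "K \<noteq> {}" unfolding K_def by blast
  define d where "d = Inf ((\<lambda>x. (norm x)\<^sup>2) ` K)"
  have bdd: "bdd_below ((\<lambda>x. (norm x)\<^sup>2) ` K)"
    by (rule bdd_belowI[of _ 0]) auto
  have d_le: "d \<le> (norm x)\<^sup>2" if "x \<in> K" for x
    unfolding d_def using that bdd by (intro cInf_lower) auto
  have "\<exists>x\<in>K. (norm x)\<^sup>2 < d + inverse (real (Suc n))" for n
  proof -
    have "Inf ((\<lambda>x. (norm x)\<^sup>2) ` K) < d + inverse (real (Suc n))" by (simp add: d_def)
    then show ?thesis using K_ne bdd by (subst (asm) cInf_less_iff) auto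
  qed
  then obtain X where XK: "\<And>n. X n \<in> K" and X: "\<And>n. (norm (X n))\<^sup>2 < d + inverse (real (Suc n))"
    by metis
  \<comment> \<open>The midpoint of \<open>X m\<close> and \<open>X n\<close> lies in
    \<open>K\<close>, so its squared norm is at least \<open>d\<close>; the parallelogram law turns
    this into a bound on the distance.\<close>
  have dist_X: "(norm (X m - X n))\<^sup>2 \<le> 2 * (inverse (real (Suc m)) + inverse (real (Suc n)))" for m n
  proof -
    have "f ((1/2) *\<^sub>R (X m + X n)) = 1"
      using XK[of m] XK[of n] by (simp add: K_def add scaleR)
    then have "d \<le> (norm ((1/2) *\<^sub>R (X m + X n)))\<^sup>2" by (intro d_le) (simp add: K_def)
    also have "\<dots> = (norm (X m + X n))\<^sup>2 / 4" by (simp add: power_divide)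
    finally have "4 * d \<le> (norm (X m + X n))\<^sup>2" by simp
    moreover have "(norm (X m - X n))\<^sup>2 + (norm (X m + X n))\<^sup>2 = 2 * (norm (X m))\<^sup>2 + 2 * (norm (X n))\<^sup>2"
      by (simp add: power2_norm_eq_inner inner_simps inner_commute)
    ultimately show ?thesis using X[of m] X[of n] by argo
  qed
  have "Cauchy X"
  proof (rule metric_CauchyI)
    fix r :: real assume "0 < r"
    then obtain N where N: "inverse (real (Suc N)) < r\<^sup>2 / 4"
      using reals_Archimedean[of "r\<^sup>2 / 4"] by auto
    have "dist (X m) (X n) < r" if "m \<ge> N" "n \<ge> N" for m n
    proof -
      have "inverse (real (Suc m)) \<le> inverse (real (Suc N))" "inverse (real (Suc n)) \<le> inverse (real (Suc N))"
        using that by (auto intro!: le_imp_inverse_le)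
      with N dist_X[of m n] have "(norm (X m - X n))\<^sup>2 < r\<^sup>2" by argo
      then show ?thesis using \<open>0 < r\<close> by (simp add: dist_norm power2_less_imp_less)
    qed
    then show "\<exists>N. \<forall>m\<ge>N. \<forall>n\<ge>N. dist (X m) (X n) < r" by blast
  qed
  then obtain z where z: "X \<longlonglongrightarrow> z" by (metis Cauchy_convergent convergent_def)
  have "(\<lambda>n. f (X n)) \<longlonglongrightarrow> f z" by (rule tendsto[OF z])
  moreover have "f (X n) = 1" for n using XK[of n] by (simp add: K_def)
  ultimately have fz: "f z = 1" by (simp add: LIMSEQ_const_iff)
  have "(\<lambda>n. (norm (X n))\<^sup>2) \<longlonglongrightarrow> (norm z)\<^sup>2" by (intro tendsto_intros z)
  moreover have "(\<lambda>n. d + inverse (real (Suc n))) \<longlonglongrightarrow> d + 0"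
    by (intro tendsto_intros LIMSEQ_inverse_real_of_nat)
  ultimately have "(norm z)\<^sup>2 \<le> d + 0"
    by (rule LIMSEQ_le) (use X in \<open>auto intro: less_imp_le\<close>)
  then have min: "(norm z)\<^sup>2 \<le> (norm x)\<^sup>2" if "f x = 1" for x
    using order_trans[OF _ d_le[of x]] that by (simp add: K_def)
  have orth: "inner z h = 0" if "f h = 0" for h
  proof (rule ccontr)
    assume ne: "inner z h \<noteq> 0"
    then have "h \<noteq> 0" by auto
    \<comment> \<open>The minimizer of the quadratic polynomial in \<open>t\<close> that gives the
      squared norm of \<open>z + t *\<^sub>R h\<close>.\<close>
    define t where "t = - inner z h / inner h h"
    have "f (z + t *\<^sub>R h) = 1" by (simp add: add scaleR fz that)
    from min[OF this] have "0 \<le> 2 * t * inner z h + t * t * inner h h"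
      by (simp add: power2_norm_eq_inner inner_simps inner_commute algebra_simps)
    also have "\<dots> = - (inner z h)\<^sup>2 / inner h h"
      using \<open>h \<noteq> 0\<close> by (simp add: t_def field_simps power2_eq_square)
    also have "\<dots> < 0"
      using ne \<open>h \<noteq> 0\<close> by (simp add: divide_less_0_iff)
    finally show False by simp
  qed
  have "z \<noteq> 0" using fz zero by auto
  show ?thesis
  proof (intro exI allI)
    fix x
    have "f (x - f x *\<^sub>R z) = 0" by (simp add: diff scaleR fz)
    from orth[OF this] have "inner z x = f x * inner z z" by (simp add: inner_simps)
    then show "f x = inner (z /\<^sub>R inner z z) x" using \<open>z \<noteq> 0\<close> by simp
  qed
qed

text \<open>The real case represents the real part of \<open>f\<close>; complex linearity recovers
  the imaginary part at \<open>x\<close> from the real part at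
  \<open>\<i> *\<^sub>C x\<close>.\<close>

lemma riesz:
  fixes f :: "'a::chilbert_space \<Rightarrow> complex"
  assumes add: "\<And>x y. f (x + y) = f x + f y" and scale: "\<And>c x. f (c *\<^sub>C x) = c * f x"
    and bound: "\<And>x. cmod (f x) \<le> K * norm x"
  shows "\<exists>y. \<forall>x. f x = cinner x y"
proof -
  have "bounded_linear (\<lambda>x. Re (f x))"
  proof (rule bounded_linear_intro[of _ K])
    show "Re (f (r *\<^sub>R x)) = r *\<^sub>R Re (f x)" for r x
      using scale[of "complex_of_real r" x] by (simp add: scaleC_of_real)
    show "norm (Re (f x)) \<le> norm x * K" for x
      using bound[of x] abs_Re_le_cmod[of "f x"] by (simp add: mult.commute)
  qed (simp add: add)
  then obtain y where y: "\<And>x. Re (f x) = inner y x" using riesz_real by blast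
  have Re: "Re (f x) = Re (cinner x y)" for x by (simp add: y Re_cinner inner_commute)
  have "f x = cinner x y" for x
    using Re[of x] Re[of "\<i> *\<^sub>C x"] by (simp add: scale cinner_scaleC_left complex_eq_iff)
  then show ?thesis by blast
qed

lemma adjoint_exists:
  fixes A :: "('a::chilbert_space, 'b::complex_inner) cblinfun"
  shows "\<exists>B :: ('b, 'a) cblinfun.
    \<forall>x y. cinner (cblinfun_apply A x) y = cinner x (cblinfun_apply B y)"
proof -
  obtain K where K: "K \<ge> 0" "\<And>x. norm (cblinfun_apply A x) \<le> K * norm x"
    using cblinfun_bound by blast
  have bd: "cmod (cinner (cblinfun_apply A x) y) \<le> K * norm x * norm y" for x y
    using cmod_cinner_le[of "cblinfun_apply A x" y] mult_right_mono[OF K(2)[of x], of "norm y"] by simp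
  have "\<exists>z. \<forall>x. cinner (cblinfun_apply A x) y = cinner x z" for y
  proof (rule riesz[where K = "K * norm y"])
    show "cmod (cinner (cblinfun_apply A x) y) \<le> K * norm y * norm x" for x
      using bd[of x y] by (simp add: mult_ac)
  qed (simp_all add: op_apply cinner_simps)
  then obtain g where g: "\<And>x y. cinner (cblinfun_apply A x) y = cinner x (g y)" by metis
  have "bounded_clinear g"
  proof (rule bounded_clinearI)
    show "g (x + y) = g x + g y" for x y
      by (rule cinner_ext_right) (simp add: cinner_simps flip: g)
    show "g (c *\<^sub>C x) = c *\<^sub>C g x" for c x
      by (rule cinner_ext_right) (simp add: cinner_simps flip: g)
    show "norm (g y) \<le> K * norm y" for y
    proof (rule norm_le_if_cinner_le)
      show "cmod (cinner (g y) x) \<le> K * norm y * norm x" for x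
        using bd[of x y] by (metis cinner_commute complex_mod_cnj g mult.assoc mult.commute)
    qed (use K in simp)
  qed
  then show ?thesis using g by (intro exI[of _ "CBlinfun g"]) (simp add: CBlinfun_apply)
qed

definition cadjoint :: "('a::chilbert_space, 'b::complex_inner) cblinfun \<Rightarrow> ('b, 'a) cblinfun"
  where "cadjoint A = (SOME B. \<forall>x y. cinner (cblinfun_apply A x) y = cinner x (cblinfun_apply B y))"

lemma cinner_adjoint_right: "cinner x (cblinfun_apply (cadjoint A) y) = cinner (cblinfun_apply A x) y"
  unfolding cadjoint_def using someI_ex[OF adjoint_exists[of A]] by metis

lemma cinner_adjoint_left: "cinner (cblinfun_apply (cadjoint A) y) x = cinner y (cblinfun_apply A x)"
  by (metis cinner_adjoint_right cinner_commute)

section \<open>Operators of rank one\<close>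

lift_definition rank1 :: "'b::complex_inner \<Rightarrow> 'a::complex_inner \<Rightarrow> ('a, 'b) cblinfun"
  is "\<lambda>y z x. cinner x z *\<^sub>C y"
proof -
  fix y :: 'b and z :: 'a
  show "bounded_clinear (\<lambda>x. cinner x z *\<^sub>C y)"
  proof (rule bounded_clinearI)
    show "norm (cinner x z *\<^sub>C y) \<le> (norm z * norm y) * norm x" for x
      using mult_right_mono[OF cmod_cinner_le[of x z], of "norm y"] by (simp add: norm_scaleC mult_ac)
  qed (simp_all add: cinner_simps scaleC_add_left scaleC_scaleC)
qed

lemma rank1_apply: "cblinfun_apply (rank1 y z) x = cinner x z *\<^sub>C y"
  by (simp add: rank1.rep_eq)

lemma rank1_add_left: "rank1 (x + y) z = rank1 x z + rank1 y z"
  and rank1_diff_left: "rank1 (x - y) z = rank1 x z - rank1 y z"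
  and rank1_scaleC_left: "rank1 (c *\<^sub>C x) z = c *\<^sub>C rank1 x z"
  and rank1_zero_left: "rank1 0 z = 0"
  by (rule cblinfun_eqI; simp add: op_apply rank1_apply scaleC_simps mult.commute)+

lemma rank1_add_right: "rank1 x (y + z) = rank1 x y + rank1 x z"
  and rank1_diff_right: "rank1 x (y - z) = rank1 x y - rank1 x z"
  and rank1_scaleC_right: "rank1 x (c *\<^sub>C z) = cnj c *\<^sub>C rank1 x z"
  and rank1_zero_right: "rank1 x 0 = 0"
  by (rule cblinfun_eqI; simp add: op_apply rank1_apply cinner_simps scaleC_simps)+

lemma compose_rank1: "A o\<^sub>C rank1 y z = rank1 (cblinfun_apply A y) z"
  by (rule cblinfun_eqI) (simp add: op_apply rank1_apply)

lemma rank1_compose: "rank1 y z o\<^sub>C A = rank1 y (cblinfun_apply (cadjoint A) z)"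
  by (rule cblinfun_eqI) (simp add: op_apply rank1_apply cinner_adjoint_right)

lemma rank1_compose_rank1: "rank1 x y o\<^sub>C rank1 z w = cinner z y *\<^sub>C rank1 x w"
  by (rule cblinfun_eqI) (simp add: op_apply rank1_apply scaleC_scaleC)

lemma rank1_sandwich: "rank1 x y o\<^sub>C B o\<^sub>C rank1 z w = cinner (cblinfun_apply B z) y *\<^sub>C rank1 x w"
  by (rule cblinfun_eqI) (simp add: op_apply rank1_apply cinner_simps scaleC_scaleC mult.commute)

lemma rank1_eq_0_iff: "rank1 y z = 0 \<longleftrightarrow> y = 0 \<or> z = 0"
proof
  assume "rank1 y z = 0"
  then have "cblinfun_apply (rank1 y z) z = 0" by (simp add: op_apply)
  then show "y = 0 \<or> z = 0" by (auto simp: rank1_apply)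
qed (auto simp: rank1_zero_left rank1_zero_right)

text \<open>Reduces claims that are linear in a rank-one operator to the operators
  \<open>rank1 x x\<close>.\<close>

lemma rank1_polarization:
  "rank1 x y = (1/4) *\<^sub>C (rank1 (x + y) (x + y) - rank1 (x - y) (x - y)
     + \<i> *\<^sub>C rank1 (x + \<i> *\<^sub>C y) (x + \<i> *\<^sub>C y) - \<i> *\<^sub>C rank1 (x - \<i> *\<^sub>C y) (x - \<i> *\<^sub>C y))"
  by (rule cblinfun_eq_cinnerI)
    (simp add: op_apply rank1_apply cinner_simps algebra_simps)

section \<open>Weakly bounded linear maps\<close>

text \<open>Uniform boundedness through Baire: the closed sets \<open>E n\<close> cover the space,
  so one of them contains a ball of test vectors with a common bound. This makes the implementing
  bijection and its inverse bounded.\<close>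

lemma weakly_bounded_imp_bounded:
  fixes U :: "'a::complex_inner \<Rightarrow> 'b::chilbert_space"
  assumes weak: "\<And>q. \<exists>K. \<forall>x. cmod (cinner (U x) q) \<le> K * norm x"
  shows "\<exists>K. \<forall>x. norm (U x) \<le> K * norm x"
proof -
  define E where "E n = {q. \<forall>x. cmod (cinner (U x) q) \<le> real n * norm x}" for n :: nat
  have clo: "closed (E n)" for n
  proof -
    have "continuous_on UNIV (\<lambda>q. cinner (U x) q)" for x
      by (auto simp: continuous_on_def intro!: tendsto_cinner_right)
    then have "closed {q. cmod (cinner (U x) q) \<le> real n * norm x}" for x
      by (intro closed_Collect_le continuous_intros)
    then show ?thesis unfolding E_def by (rule closed_Collect_all)
  qed
  have cover: "(\<Union>n. E n) = UNIV"
  proof -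
    have "\<exists>n. q \<in> E n" for q
    proof -
      obtain K where K: "\<And>x. cmod (cinner (U x) q) \<le> K * norm x" using weak by blast
      obtain n where "K \<le> real n" using real_arch_simple by blast
      then have "cmod (cinner (U x) q) \<le> real n * norm x" for x
        using K[of x] mult_right_mono[of K "real n" "norm x"] by simp
      then show ?thesis unfolding E_def by blast
    qed
    then show ?thesis by blast
  qed
  have "\<exists>n. interior (E n) \<noteq> {}"
  proof (rule ccontr)
    assume "\<not> ?thesis"
    then have "Met_TC.mtopology interior_of \<Union>(range E) = {}"
      by (intro Met_TC.metric_Baire_category_alt) (use clo in auto)
    then show False using cover by simp
  qed
  then obtain n q r where r: "r > 0" and "ball q r \<subseteq> E n"
    by (metis all_not_in_conv mem_interior)
  then have E: "q' \<in> E n" if "dist q q' < r" for q' using that by auto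
  have bd: "norm (U x) \<le> (4 * real n / r) * norm x" for x
  proof (rule norm_le_if_cinner_le)
    fix y
    show "cmod (cinner (U x) y) \<le> 4 * real n / r * norm x * norm y"
    proof (cases "y = 0")
      case False
      \<comment> \<open>Scales \<open>y\<close> to length \<open>r / 2\<close>, so that it becomes a
        difference of two points of the ball inside \<open>E n\<close>.\<close>
      define c where "c = complex_of_real (r / (2 * norm y))"
      have c: "cmod c = r / (2 * norm y)" using r by (simp add: c_def norm_divide norm_mult)
      have "q + c *\<^sub>C y \<in> E n" using r False by (intro E) (simp add: dist_norm norm_scaleC c)
      moreover have "q \<in> E n" using r by (intro E) simp
      ultimately have "cmod (cinner (U x) (q + c *\<^sub>C y)) \<le> real n * norm x"
        "cmod (cinner (U x) q) \<le> real n * norm x" unfolding E_def by blast+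
      moreover have "cnj c * cinner (U x) y = cinner (U x) (q + c *\<^sub>C y) - cinner (U x) q"
        by (simp add: cinner_simps)
      ultimately have "cmod (cnj c * cinner (U x) y) \<le> 2 * (real n * norm x)"
        using norm_triangle_ineq4[of "cinner (U x) (q + c *\<^sub>C y)" "cinner (U x) q"] by simp
      then show ?thesis using r False by (simp add: norm_mult c field_simps)
    qed simp
  qed (use r in simp)
  then show ?thesis by blast
qed

section \<open>A Sylvester equation\<close>

text \<open>For small \<open>\<epsilon>\<close> the equation is a fixed-point problem for a
  contraction. The iteration runs in the Banach space of real-linear bounded operators; complex
  linearity of the solution is recovered afterwards.\<close>

lemma sylvester_solvable:
  fixes B E :: "('a::chilbert_space, 'a) cblinfun"
  shows "\<exists>\<epsilon>>0. \<exists>X. X + X + complex_of_real \<epsilon> *\<^sub>C (B \<circ>\<^sub>J X) = E"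
proof -
  define b where "b = Blinfun (cblinfun_apply B)"
  define e where "e = Blinfun (cblinfun_apply E)"
  define j where "j = Blinfun (\<lambda>x :: 'a. \<i> *\<^sub>C x)"
  have b: "blinfun_apply b x = cblinfun_apply B x" for x
    by (simp add: b_def bounded_linear_Blinfun_apply bounded_linear_apply)
  have e: "blinfun_apply e x = cblinfun_apply E x" for x
    by (simp add: e_def bounded_linear_Blinfun_apply bounded_linear_apply)
  have i_scaleR: "\<i> *\<^sub>C (r *\<^sub>R x) = r *\<^sub>R (\<i> *\<^sub>C x)" for r and x :: 'a
    by (simp add: scaleC_scaleC mult.commute flip: scaleC_of_real)
  have "bounded_linear (\<lambda>x :: 'a. \<i> *\<^sub>C x)"
    by (rule bounded_linear_intro[of _ 1]) (simp_all add: scaleC_add_right i_scaleR norm_scaleC)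
  then have j: "blinfun_apply j x = \<i> *\<^sub>C x" for x
    by (simp add: j_def bounded_linear_Blinfun_apply)
  \<comment> \<open>The Lipschitz constant of \<open>F\<close> is at most
    \<open>\<epsilon> * norm b\<close>, hence at most 1/2; the added 1 covers
    \<open>b = 0\<close>.\<close>
  define \<epsilon> where "\<epsilon> = 1 / (2 * (norm b + 1))"
  have \<epsilon>: "\<epsilon> > 0" "\<epsilon> * norm b \<le> 1/2"
    using norm_ge_zero[of b] by (simp_all add: \<epsilon>_def field_simps add_pos_nonneg)
  define F where "F X = (1/2) *\<^sub>R (e - \<epsilon> *\<^sub>R ((b o\<^sub>L X) + (X o\<^sub>L b)))" for X
  have "dist (F X) (F Y) \<le> 1/2 * dist X Y" for X Y
  proof -
    have "F X - F Y = - (\<epsilon>/2) *\<^sub>R ((b o\<^sub>L (X - Y)) + ((X - Y) o\<^sub>L b))"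
      by (rule blinfun_eqI)
        (simp add: F_def blinfun.bilinear_simps scaleR_add_right scaleR_diff_right)
    then have "dist (F X) (F Y) = (\<epsilon>/2) * norm ((b o\<^sub>L (X - Y)) + ((X - Y) o\<^sub>L b))"
      using \<epsilon> by (simp add: dist_norm)
    also have "norm ((b o\<^sub>L (X - Y)) + ((X - Y) o\<^sub>L b)) \<le> 2 * (norm b * norm (X - Y))"
      using norm_triangle_ineq[of "b o\<^sub>L (X - Y)" "(X - Y) o\<^sub>L b"]
        norm_blinfun_compose[of b "X - Y"] norm_blinfun_compose[of "X - Y" b]
      by (simp add: mult.commute)
    also have "(\<epsilon>/2) * (2 * (norm b * norm (X - Y))) = (\<epsilon> * norm b) * norm (X - Y)" by simp
    also have "\<dots> \<le> 1/2 * norm (X - Y)" by (rule mult_right_mono) (use \<epsilon> in auto)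
    finally show ?thesis using \<epsilon> by (simp add: dist_norm mult_left_mono)
  qed
  then have uniq: "\<exists>!X. F X = X" by (intro banach_fix_type[of "1/2"]) auto
  then obtain X where X: "F X = X" by blast
  define X' where "X' = - (j o\<^sub>L X o\<^sub>L j)"
  have jj: "\<i> *\<^sub>C \<i> *\<^sub>C x = - x" for x :: 'a by (simp add: scaleC_scaleC scaleC_minus1)
  \<comment> \<open>The fixed point is a priori only real linear; conjugating it with \<open>\<i>\<close> gives
    another fixed point, so uniqueness makes it complex linear.\<close>
  have "F X' = X'"
  proof (rule blinfun_eqI)
    fix x
    have "blinfun_apply X' x = - (\<i> *\<^sub>C blinfun_apply (F X) (\<i> *\<^sub>C x))"
      by (simp add: X'_def X blinfun.bilinear_simps j)
    also have "\<dots> = blinfun_apply (F X') x"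
      by (simp add: F_def X'_def blinfun.bilinear_simps j b e apply_scaleC apply_minus jj
          scaleC_add_right complex_vector.scale_right_diff_distrib i_scaleR scaleR_diff_right
          scaleR_add_right)
    finally show "blinfun_apply (F X') x = blinfun_apply X' x" ..
  qed
  with uniq X have X': "X' = X" by blast
  have Xi: "blinfun_apply X (\<i> *\<^sub>C x) = \<i> *\<^sub>C blinfun_apply X x" for x
  proof -
    have "blinfun_apply X (\<i> *\<^sub>C x) = blinfun_apply X' (\<i> *\<^sub>C x)" by (simp add: X')
    also have "\<dots> = \<i> *\<^sub>C blinfun_apply X x"
      by (simp add: X'_def blinfun.bilinear_simps j jj)
    finally show ?thesis .
  qed
  have Xc: "blinfun_apply X (c *\<^sub>C x) = c *\<^sub>C blinfun_apply X x" for c x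
  proof -
    have c: "c *\<^sub>C y = Re c *\<^sub>R y + Im c *\<^sub>R (\<i> *\<^sub>C y)" for y :: 'a
      by (simp add: scaleC_scaleC flip: scaleC_of_real scaleC_add_left)
        (metis complex_eq mult.commute)
    show ?thesis by (simp add: c[of x] c[of "blinfun_apply X x"] blinfun.bilinear_simps Xi)
  qed
  have "bounded_clinear (blinfun_apply X)"
    by (rule bounded_clinearI[where K = "norm X"]) (simp_all add: blinfun.bilinear_simps Xc norm_blinfun)
  then have X0: "cblinfun_apply (CBlinfun (blinfun_apply X)) x = blinfun_apply X x" for x
    by (rule CBlinfun_apply)
  have "CBlinfun (blinfun_apply X) + CBlinfun (blinfun_apply X)
      + complex_of_real \<epsilon> *\<^sub>C (B \<circ>\<^sub>J CBlinfun (blinfun_apply X)) = E"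
  proof (rule cblinfun_eqI)
    fix x
    have "blinfun_apply X x + blinfun_apply X x = 2 *\<^sub>R blinfun_apply (F X) x"
      by (simp add: X scaleR_2)
    also have "\<dots> = cblinfun_apply E x - \<epsilon> *\<^sub>R (cblinfun_apply B (blinfun_apply X x)
        + blinfun_apply X (cblinfun_apply B x))"
      by (simp add: F_def blinfun.bilinear_simps b e)
    finally show "cblinfun_apply (CBlinfun (blinfun_apply X) + CBlinfun (blinfun_apply X)
      + complex_of_real \<epsilon> *\<^sub>C (B \<circ>\<^sub>J CBlinfun (blinfun_apply X))) x = cblinfun_apply E x"
      by (simp add: op_apply X0 scaleC_of_real)
  qed
  with \<epsilon> show ?thesis by blast
qed

lemma unit_multiple:
  assumes "x \<noteq> (0 :: 'a::complex_inner)"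
  obtains c u where "c \<noteq> 0" "norm u = 1" "x = c *\<^sub>C u"
proof
  show "complex_of_real (norm x) \<noteq> 0" using assms by simp
  show "norm (inverse (complex_of_real (norm x)) *\<^sub>C x) = 1"
    using assms by (simp add: norm_scaleC norm_inverse)
  show "x = complex_of_real (norm x) *\<^sub>C inverse (complex_of_real (norm x)) *\<^sub>C x"
    using assms by (simp add: scaleC_simps)
qed

section \<open>Symmetric forms vanishing on pairs with a given Jordan product\<close>

text \<open>Applied to the matrix coefficients of the operator-valued form built from
  \<open>\<Psi>\<close>. Scalar values allow limits in a real parameter although
  \<open>\<gamma>\<close> carries no continuity assumption: every such limit concerns an explicit
  rational function with fixed values of \<open>\<gamma>\<close> as coefficients.\<close>

locale jordan_form =
  fixes \<gamma> :: "('a::chilbert_space, 'a) cblinfun \<Rightarrow> ('a, 'a) cblinfun \<Rightarrow> complex"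
    and D :: "('a, 'a) cblinfun"
  assumes add_left: "\<gamma> (A + B) C = \<gamma> A C + \<gamma> B C"
    and scale_left: "\<gamma> (c *\<^sub>C A) C = c * \<gamma> A C"
    and sym: "\<gamma> A B = \<gamma> B A"
    and id: "\<gamma> cblinfun_id A = 0"
    and vanish: "A \<circ>\<^sub>J B = D \<Longrightarrow> \<gamma> A B = 0"
begin

lemma add_right: "\<gamma> A (B + C) = \<gamma> A B + \<gamma> A C"
  by (metis add_left sym)

lemma scale_right: "\<gamma> A (c *\<^sub>C B) = c * \<gamma> A B"
  by (metis scale_left sym)

lemma minus_left: "\<gamma> (- A) B = - \<gamma> A B"
  using scale_left[of "- 1" A B] by (simp add: scaleC_minus1)

lemma diff_left: "\<gamma> (A - B) C = \<gamma> A C - \<gamma> B C"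
  using add_left[of A "- B" C] by (simp add: minus_left)

lemma diff_right: "\<gamma> A (B - C) = \<gamma> A B - \<gamma> A C"
  by (metis diff_left sym)

lemma zero_left: "\<gamma> 0 A = 0"
  using add_left[of 0 0 A] by simp

lemmas form_simps = add_left scale_left diff_left minus_left add_right scale_right diff_right

text \<open>With \<open>Q = rank1 x x\<close>, the operators \<open>a Q + (1 - Q) + B\<close> have an explicit partner,
  whose \<open>Q\<close>-component has a simple pole at \<open>a = 0\<close>; the claim is the vanishing of the residue.\<close>

lemma form_residue:
  fixes x :: 'a
  defines "Q \<equiv> rank1 x x"
  defines "d \<equiv> cinner (cblinfun_apply D x) x"
  assumes x: "norm x = 1" and d: "d \<noteq> 0" and \<epsilon>: "\<epsilon> > 0"
    and BQ: "B \<circ>\<^sub>J Q = 0" and QX: "Q \<circ>\<^sub>J X = 0"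
    and QY: "Q \<circ>\<^sub>J Y\<^sub>1 = Y\<^sub>1" "Q \<circ>\<^sub>J Y\<^sub>2 = Y\<^sub>2"
    and BY: "B \<circ>\<^sub>J Y\<^sub>1 = complex_of_real \<epsilon> *\<^sub>C Y\<^sub>1" "B \<circ>\<^sub>J Y\<^sub>2 = 0"
    and D: "D = d *\<^sub>C Q + Y\<^sub>1 + Y\<^sub>2 + (X + X + B \<circ>\<^sub>J X)"
  shows "\<gamma> (cblinfun_id - Q + B) Q = 0"
proof -
  define M where "M = cblinfun_id - Q + B"
  have xx: "cinner x x = 1" by (simp add: cinner_self x)
  have QQ: "Q \<circ>\<^sub>J Q = 2 *\<^sub>C Q"
    unfolding Q_def by (rule cblinfun_eqI) (simp add: op_apply rank1_apply cinner_simps xx flip: scaleC_add_left)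
  have twice: "A + A = 2 *\<^sub>C A" for A :: "('a, 'a) cblinfun"
    by (metis one_add_one scaleC_add_left scaleC_one)
  \<comment> \<open>Jordan multiplication by \<open>a *\<^sub>C Q + M\<close> has \<open>Q\<close>,
    \<open>Y\<^sub>1\<close> and \<open>Y\<^sub>2\<close> as eigenvectors with eigenvalues 2a, a + 1
    + \<epsilon> and a + 1, and sends \<open>X\<close> to a term free of \<open>a\<close>. Matching
    coefficients with \<open>D\<close> gives the partner \<open>Z\<close> below, with the pole d /
    (2a) at \<open>Q\<close>.\<close>
  have product: "(a *\<^sub>C Q + M) \<circ>\<^sub>J (p *\<^sub>C Q + r *\<^sub>C Y\<^sub>1 + s *\<^sub>C Y\<^sub>2 + X)
      = (a * p * 2) *\<^sub>C Q + ((a + 1 + \<epsilon>) * r) *\<^sub>C Y\<^sub>1 + ((a + 1) * s) *\<^sub>C Y\<^sub>2 + (X + X + B \<circ>\<^sub>J X)"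
    for a p r s
    unfolding M_def
    by (rule cblinfun_eq_cinnerI, simp only: jordan_simps QQ QY BY BQ QX)
      (simp add: op_apply cinner_simps algebra_simps)
  \<comment> \<open>The form at the pair, multiplied by \<open>z\<close> to cancel the pole. This
    expression is continuous at 0, where only the residue \<open>(d / 2) * \<gamma> M Q\<close>
    survives.\<close>
  define h where "h z = (d * z / 2) * \<gamma> Q Q + (d / 2) * \<gamma> M Q
      + z * (z * (\<gamma> Q Y\<^sub>1 / (z + 1 + \<epsilon>) + \<gamma> Q Y\<^sub>2 / (z + 1) + \<gamma> Q X)
        + (\<gamma> M Y\<^sub>1 / (z + 1 + \<epsilon>) + \<gamma> M Y\<^sub>2 / (z + 1) + \<gamma> M X))" for z :: complex
  have h0: "h (complex_of_real a) = 0" if a: "a > 0" for a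
  proof -
    define z where "z = complex_of_real a"
    have ne: "z \<noteq> 0" "z + 1 \<noteq> 0" "z + 1 + \<epsilon> \<noteq> 0"
      using a \<epsilon> by (simp_all add: z_def complex_eq_iff)
    define Z where "Z = (d / (2 * z)) *\<^sub>C Q + (1 / (z + 1 + \<epsilon>)) *\<^sub>C Y\<^sub>1 + (1 / (z + 1)) *\<^sub>C Y\<^sub>2 + X"
    have "(z *\<^sub>C Q + M) \<circ>\<^sub>J Z = (z * (d / (2 * z)) * 2) *\<^sub>C Q
        + ((z + 1 + \<epsilon>) * (1 / (z + 1 + \<epsilon>))) *\<^sub>C Y\<^sub>1 + ((z + 1) * (1 / (z + 1))) *\<^sub>C Y\<^sub>2
        + (X + X + B \<circ>\<^sub>J X)"
      unfolding Z_def by (rule product)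
    also have "\<dots> = D" using ne by (simp add: D scaleC_one)
    finally have "\<gamma> (z *\<^sub>C Q + M) Z = 0" by (rule vanish)
    then have "z * \<gamma> (z *\<^sub>C Q + M) Z = 0" by simp
    also have "z * \<gamma> (z *\<^sub>C Q + M) Z = h z"
      using ne(1) by (simp add: Z_def h_def form_simps algebra_simps)
    finally show ?thesis by (simp add: z_def)
  qed
  have "((\<lambda>a. h (complex_of_real a)) \<longlongrightarrow> h (complex_of_real 0)) (at_right 0)"
    unfolding h_def by (intro tendsto_intros) (use \<epsilon> in \<open>auto simp: complex_eq_iff\<close>)
  moreover have "((\<lambda>a. h (complex_of_real a)) \<longlongrightarrow> 0) (at_right 0)"
    by (rule tendsto_eventually, rule eventually_mono[OF eventually_at_right_less]) (rule h0)
  ultimately have "h (complex_of_real 0) = 0"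
    by (rule tendsto_unique[OF trivial_limit_at_right_real])
  then have "(d / 2) * \<gamma> M Q = 0" by (simp add: h_def)
  then show ?thesis using d by (simp add: M_def)
qed

text \<open>Supplies the data of \<open>form_residue\<close> from a splitting of the off-diagonal
  part of \<open>D\<close> into eigenvectors of Jordan multiplication by \<open>B\<close>. The
  remaining corner of \<open>D\<close> is handled by the Sylvester equation, at the price of scaling
  \<open>B\<close> by \<open>\<epsilon>\<close>.\<close>

lemma form_corner_aux:
  fixes x :: 'a
  defines "Q \<equiv> rank1 x x"
  assumes x: "norm x = 1" and d: "cinner (cblinfun_apply D x) x \<noteq> 0"
    and BQ: "B o\<^sub>C Q = 0" and QB: "Q o\<^sub>C B = 0"
    and QY: "Q \<circ>\<^sub>J Y\<^sub>1 = Y\<^sub>1" "Q \<circ>\<^sub>J Y\<^sub>2 = Y\<^sub>2"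
    and BY: "B \<circ>\<^sub>J Y\<^sub>1 = Y\<^sub>1" "B \<circ>\<^sub>J Y\<^sub>2 = 0"
    and Y: "Y\<^sub>1 + Y\<^sub>2 = Q o\<^sub>C D o\<^sub>C (cblinfun_id - Q) + (cblinfun_id - Q) o\<^sub>C D o\<^sub>C Q"
  shows "\<exists>\<epsilon>>0. \<gamma> (cblinfun_id - Q + complex_of_real \<epsilon> *\<^sub>C B) Q = 0"
proof -
  define R where "R = cblinfun_id - Q"
  have xx: "cinner x x = 1" by (simp add: cinner_self x)
  have QQ: "Q o\<^sub>C Q = Q"
    unfolding Q_def by (simp add: rank1_compose_rank1 xx scaleC_one)
  have QDQ: "Q o\<^sub>C D o\<^sub>C Q = cinner (cblinfun_apply D x) x *\<^sub>C Q"
    unfolding Q_def by (simp add: compose_assoc compose_rank1 rank1_compose_rank1)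
      (simp add: op_apply rank1_apply rank1_scaleC_left)
  obtain \<epsilon> X where \<epsilon>: "\<epsilon> > 0"
    and X: "X + X + complex_of_real \<epsilon> *\<^sub>C (B \<circ>\<^sub>J X) = R o\<^sub>C D o\<^sub>C R"
    using sylvester_solvable[of B "R o\<^sub>C D o\<^sub>C R"] by blast
  \<comment> \<open>\<open>R\<close> acts as a unit on \<open>B\<close> from both sides, so the
    compression of \<open>X\<close> to the corner of \<open>R\<close> solves the same equation and
    is annihilated by \<open>Q\<close>.\<close>
  define X' where "X' = R o\<^sub>C X o\<^sub>C R"
  have RR: "R o\<^sub>C R = R" by (simp add: R_def compose_simps QQ)
  have BR: "B o\<^sub>C R = B" "R o\<^sub>C B = B" by (simp_all add: R_def compose_simps QB BQ)
  have RRX: "R o\<^sub>C (R o\<^sub>C A) = R o\<^sub>C A" "B o\<^sub>C (R o\<^sub>C A) = B o\<^sub>C A" "R o\<^sub>C (B o\<^sub>C A) = B o\<^sub>C A" for A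
    by (simp_all add: RR BR flip: compose_assoc)
  have "R o\<^sub>C (X + X + complex_of_real \<epsilon> *\<^sub>C (B \<circ>\<^sub>J X)) o\<^sub>C R = R o\<^sub>C D o\<^sub>C R"
    unfolding X by (simp add: compose_assoc RR RRX)
  then have X': "X' + X' + complex_of_real \<epsilon> *\<^sub>C (B \<circ>\<^sub>J X') = R o\<^sub>C D o\<^sub>C R"
    unfolding jordan_product_def X'_def by (simp add: compose_simps RR RRX BR)
  have "\<gamma> (cblinfun_id - Q + complex_of_real \<epsilon> *\<^sub>C B) Q = 0"
    unfolding Q_def
  proof (rule form_residue[OF x d \<epsilon>])
    show "(complex_of_real \<epsilon> *\<^sub>C B) \<circ>\<^sub>J rank1 x x = 0"
      using QB BQ by (simp add: Q_def jordan_product_def compose_simps)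
    have "Q o\<^sub>C R = 0" "R o\<^sub>C Q = 0" by (simp_all add: R_def compose_simps QQ)
    then have "Q o\<^sub>C X' = 0" "X' o\<^sub>C Q = 0"
      by (simp_all add: X'_def compose_simps flip: compose_assoc) (simp add: compose_simps)
    then show "rank1 x x \<circ>\<^sub>J X' = 0" by (simp add: jordan_product_def Q_def)
    show "rank1 x x \<circ>\<^sub>J Y\<^sub>1 = Y\<^sub>1" "rank1 x x \<circ>\<^sub>J Y\<^sub>2 = Y\<^sub>2" using QY by (simp_all add: Q_def)
    show "(complex_of_real \<epsilon> *\<^sub>C B) \<circ>\<^sub>J Y\<^sub>1 = complex_of_real \<epsilon> *\<^sub>C Y\<^sub>1" "(complex_of_real \<epsilon> *\<^sub>C B) \<circ>\<^sub>J Y\<^sub>2 = 0"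
      using BY by (simp_all add: jordan_simps)
    have "D = Q o\<^sub>C D o\<^sub>C Q + (Q o\<^sub>C D o\<^sub>C R + R o\<^sub>C D o\<^sub>C Q) + R o\<^sub>C D o\<^sub>C R"
      by (simp add: R_def compose_simps)
    also have "\<dots> = cinner (cblinfun_apply D x) x *\<^sub>C rank1 x x + Y\<^sub>1 + Y\<^sub>2 + (X' + X' + (complex_of_real \<epsilon> *\<^sub>C B) \<circ>\<^sub>J X')"
      using X' Y by (simp add: QDQ R_def jordan_simps) (simp add: Q_def)
    finally show "D = cinner (cblinfun_apply D x) x *\<^sub>C rank1 x x + Y\<^sub>1 + Y\<^sub>2 + (X' + X' + (complex_of_real \<epsilon> *\<^sub>C B) \<circ>\<^sub>J X')" .
  qed
  with \<epsilon> show ?thesis by blast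
qed

text \<open>For \<open>D = 0\<close> orthogonal operators are an admissible pair already. Otherwise
  \<open>B\<close> is treated in stages: first 0, which gives the value at \<open>Q\<close> itself,
  then projections of rank one, then rank-one operators by polarization, and finally any
  \<open>B\<close> after a finite-rank correction that makes it annihilate the off-diagonal part of
  \<open>D\<close>.\<close>

lemma form_corner:
  fixes x :: 'a
  assumes x: "norm x = 1" and good: "D = 0 \<or> cinner (cblinfun_apply D x) x \<noteq> 0"
  shows form_self: "\<gamma> (rank1 x x) (rank1 x x) = 0"
    and form_orthogonal: "B o\<^sub>C rank1 x x = 0 \<Longrightarrow> rank1 x x o\<^sub>C B = 0 \<Longrightarrow> \<gamma> B (rank1 x x) = 0"
proof -
  define Q where "Q = rank1 x x"
  have xx: "cinner x x = 1" by (simp add: cinner_self x)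
  have QQ: "Q o\<^sub>C Q = Q"
    unfolding Q_def by (simp add: rank1_compose_rank1 xx scaleC_one)
  have "\<gamma> Q Q = 0 \<and> (B o\<^sub>C Q = 0 \<longrightarrow> Q o\<^sub>C B = 0 \<longrightarrow> \<gamma> B Q = 0)" for B
  proof (cases "D = 0")
    case True
    have *: "\<gamma> B Q = 0" if "B o\<^sub>C Q = 0" "Q o\<^sub>C B = 0" for B
      by (rule vanish) (use that True in \<open>simp add: jordan_product_def\<close>)
    have "\<gamma> (cblinfun_id - Q) Q = 0" by (rule *) (simp_all add: compose_simps QQ)
    then show ?thesis using * by (simp add: diff_left id)
  next
    case False
    define d where "d = cinner (cblinfun_apply D x) x"
    have d: "cinner (cblinfun_apply D x) x \<noteq> 0" using good False by blast
    \<comment> \<open>\<open>k\<close> and \<open>w\<close> are the off-diagonal components of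
      \<open>D\<close> relative to \<open>Q\<close>: the column is \<open>rank1 k x\<close> and the
      row is \<open>rank1 x w\<close>.\<close>
    define k where "k = cblinfun_apply D x - d *\<^sub>C x"
    define w where "w = cblinfun_apply (cadjoint D) x - cnj d *\<^sub>C x"
    have kx: "cinner k x = 0" by (simp add: k_def cinner_simps d_def xx)
    have wx: "cinner w x = 0"
      by (simp add: w_def cinner_simps d_def xx cinner_adjoint_left)
        (metis cinner_commute diff_self)
    have xk: "cinner x k = 0" and xw: "cinner x w = 0" using kx wx by (simp_all add: cinner_eq_0_sym)
    have Y: "rank1 x w + rank1 k x = Q o\<^sub>C D o\<^sub>C (cblinfun_id - Q) + (cblinfun_id - Q) o\<^sub>C D o\<^sub>C Q"
      by (rule cblinfun_eq_cinnerI)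
        (simp add: op_apply rank1_apply cinner_simps Q_def k_def w_def d_def cinner_adjoint_right algebra_simps)
    have Qxw: "Q \<circ>\<^sub>J rank1 x v = rank1 x v" "Q \<circ>\<^sub>J rank1 v x = rank1 v x" if "cinner v x = 0" for v
      using that cinner_eq_0_sym[of x v]
      by (simp_all add: Q_def jordan_product_def rank1_compose_rank1 xx scaleC_one)
    have "\<exists>\<epsilon>>0. \<gamma> (cblinfun_id - rank1 x x + complex_of_real \<epsilon> *\<^sub>C 0) (rank1 x x) = 0"
    proof (rule form_corner_aux[OF x d, where Y\<^sub>1 = 0 and Y\<^sub>2 = "rank1 x w + rank1 k x"])
      show "0 + (rank1 x w + rank1 k x) = rank1 x x o\<^sub>C D o\<^sub>C (cblinfun_id - rank1 x x)
          + (cblinfun_id - rank1 x x) o\<^sub>C D o\<^sub>C rank1 x x"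
        using Y by (simp add: Q_def)
    qed (use Qxw wx kx in \<open>auto simp: compose_zero_left compose_zero_right jordan_simps Q_def\<close>)
    then have "\<gamma> (cblinfun_id - Q) Q = 0" by (simp add: Q_def)
    then have QQ0: "\<gamma> Q Q = 0" by (simp add: diff_left id)
    \<comment> \<open>As \<open>\<gamma>\<close> vanishes at \<open>(cblinfun_id, Q)\<close> and at
      \<open>(Q, Q)\<close>, the residue at \<open>Q\<close> reduces to a non-zero multiple of
      \<open>\<gamma> B Q\<close>.\<close>
    have corner: "\<gamma> B Q = 0"
      if B: "B o\<^sub>C Q = 0" "Q o\<^sub>C B = 0" "B \<circ>\<^sub>J Y\<^sub>1 = Y\<^sub>1" "B \<circ>\<^sub>J Y\<^sub>2 = 0"
        "Q \<circ>\<^sub>J Y\<^sub>1 = Y\<^sub>1" "Q \<circ>\<^sub>J Y\<^sub>2 = Y\<^sub>2" "Y\<^sub>1 + Y\<^sub>2 = rank1 x w + rank1 k x" for B Y\<^sub>1 Y\<^sub>2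
    proof -
      have "\<exists>\<epsilon>>0. \<gamma> (cblinfun_id - rank1 x x + complex_of_real \<epsilon> *\<^sub>C B) (rank1 x x) = 0"
        by (rule form_corner_aux[OF x d, where Y\<^sub>1 = Y\<^sub>1 and Y\<^sub>2 = Y\<^sub>2])
          (use B Y in \<open>simp_all add: Q_def\<close>)
      then show ?thesis using QQ0 by (auto simp: Q_def form_simps id)
    qed
    have proj1: "\<gamma> (rank1 p p) Q = 0" if p: "cinner p x = 0" "norm p = 1" for p
    proof -
      have pp: "cinner p p = 1" and xp: "cinner x p = 0"
        using p by (simp_all add: cinner_self cinner_eq_0_sym)
      \<comment> \<open>The Jordan product of \<open>rank1 p p\<close> with the off-diagonal part of
        \<open>D\<close>; Jordan multiplication by \<open>rank1 p p\<close> fixes it and annihilates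
        the remainder \<open>Y\<^sub>2\<close>.\<close>
      define Y\<^sub>1 where "Y\<^sub>1 = cinner p w *\<^sub>C rank1 x p + cinner k p *\<^sub>C rank1 p x"
      define Y\<^sub>2 where "Y\<^sub>2 = rank1 x w + rank1 k x - Y\<^sub>1"
      have Q1: "Q \<circ>\<^sub>J Y\<^sub>1 = Y\<^sub>1" using p by (simp add: Y\<^sub>1_def jordan_simps Qxw)
      have B1: "rank1 p p \<circ>\<^sub>J Y\<^sub>1 = Y\<^sub>1"
        by (simp add: Y\<^sub>1_def jordan_simps jordan_product_def compose_simps rank1_compose_rank1 p xp pp
            scaleC_one add.commute)
      have "rank1 p p \<circ>\<^sub>J (rank1 x w + rank1 k x) = Y\<^sub>1"
        by (simp add: Y\<^sub>1_def jordan_simps jordan_product_def compose_simps rank1_compose_rank1 p xp add.commute)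
      then show ?thesis
        by (intro corner[where Y\<^sub>1 = Y\<^sub>1 and Y\<^sub>2 = Y\<^sub>2])
          (use Q1 B1 wx kx in \<open>simp_all add: Q_def[symmetric] Y\<^sub>2_def jordan_simps Qxw,
            simp_all add: Q_def compose_simps rank1_compose_rank1 p xp\<close>)
    qed
    have proj: "\<gamma> (rank1 p p) Q = 0" if p: "cinner p x = 0" for p
    proof (cases "p = 0")
      case False
      define c where "c = complex_of_real (norm p)"
      define q where "q = inverse c *\<^sub>C p"
      have "c \<noteq> 0" using False by (simp add: c_def)
      then have "p = c *\<^sub>C q" by (simp add: q_def scaleC_simps)
      moreover have "norm q = 1" using False by (simp add: q_def norm_scaleC c_def norm_inverse)
      moreover have "cinner q x = 0" by (simp add: q_def cinner_simps p)
      ultimately show ?thesis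
        by (simp add: rank1_scaleC_left rank1_scaleC_right scale_left proj1)
    qed (simp add: rank1_zero_left zero_left)
    have orth: "\<gamma> (rank1 y z) Q = 0" if "cinner y x = 0" "cinner z x = 0" for y z
      by (subst rank1_polarization) (use that in \<open>simp add: form_simps proj cinner_simps\<close>)
    have "\<gamma> B Q = 0" if B: "B o\<^sub>C Q = 0" "Q o\<^sub>C B = 0"
    proof -
      \<comment> \<open>A finite-rank \<open>G\<close> in the same corner with \<open>(B - G) k = 0\<close> and \<open>(B - G)\<^sup>* w = 0\<close>;
        if \<open>k = 0\<close> or \<open>w = 0\<close>, then division by zero makes \<open>v\<close> or \<open>u\<close> zero, as needed.\<close>
      define v where "v = (1 / cinner k k) *\<^sub>C k"
      define u where "u = (1 / cinner w w) *\<^sub>C w"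
      define G where "G = rank1 (cblinfun_apply B k) v + rank1 u (cblinfun_apply (cadjoint B) w)
        - cinner (cblinfun_apply B k) w *\<^sub>C rank1 u v"
      have "cblinfun_apply (B o\<^sub>C Q) x = 0" using B by (simp add: op_apply)
      then have Bx: "cblinfun_apply B x = 0" by (simp add: op_apply Q_def rank1_apply xx)
      have xB: "cinner (cblinfun_apply B y) x = 0" for y
      proof -
        have "cblinfun_apply (Q o\<^sub>C B) y = 0" using B by (simp add: op_apply)
        then have "cinner (cblinfun_apply (Q o\<^sub>C B) y) x = 0" by simp
        then show ?thesis by (simp add: op_apply Q_def rank1_apply cinner_simps xx)
      qed
      have orths: "cinner v x = 0" "cinner u x = 0" "cinner (cblinfun_apply (cadjoint B) w) x = 0"
        by (simp_all add: v_def u_def cinner_simps kx wx cinner_adjoint_left Bx)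
      then have orths': "cinner x v = 0" "cinner x u = 0" "cinner x (cblinfun_apply (cadjoint B) w) = 0"
        by (simp_all add: cinner_eq_0_sym)
      have \<gamma>G: "\<gamma> G Q = 0" by (simp add: G_def form_simps orth orths xB)
      have kv: "k = 0 \<or> cinner k v = 1" by (simp add: v_def cinner_simps cinner_self)
      have uw: "w = 0 \<or> cinner u w = 1" by (simp add: u_def cinner_simps)
      define C where "C = B - G"
      have Ck: "cblinfun_apply C k = 0"
        using kv by (auto simp: C_def G_def op_apply rank1_apply cinner_adjoint_right scaleC_simps)
      have Cw: "cinner (cblinfun_apply C y) w = 0" for y
        using uw by (auto simp: C_def G_def op_apply rank1_apply cinner_adjoint_right cinner_simps)
      have Cx: "cblinfun_apply C x = 0"
        by (simp add: C_def G_def op_apply rank1_apply orths' Bx)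
      have xC: "cinner (cblinfun_apply C y) x = 0" for y
        by (simp add: C_def G_def op_apply rank1_apply orths xB cinner_simps)
      have "\<gamma> C Q = 0"
      proof (rule corner[where Y\<^sub>1 = 0 and Y\<^sub>2 = "rank1 x w + rank1 k x"])
        show "C o\<^sub>C Q = 0" "Q o\<^sub>C C = 0"
          by (rule cblinfun_eqI; simp add: op_apply Q_def rank1_apply Cx xC)+
        show "C \<circ>\<^sub>J (rank1 x w + rank1 k x) = 0"
          by (rule cblinfun_eqI) (simp add: op_apply rank1_apply Cx xC Ck Cw)
      qed (use wx kx in \<open>simp_all add: jordan_simps Qxw\<close>)
      then show ?thesis using \<gamma>G by (simp add: C_def diff_left)
    qed
    with QQ0 show ?thesis by blast
  qed
  then show "\<gamma> (rank1 x x) (rank1 x x) = 0"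
    and "B o\<^sub>C rank1 x x = 0 \<Longrightarrow> rank1 x x o\<^sub>C B = 0 \<Longrightarrow> \<gamma> B (rank1 x x) = 0"
    unfolding Q_def by blast+
qed

section \<open>From vectors in general position to all operators of rank one\<close>

abbreviation good :: "'a \<Rightarrow> bool"
  where "good x \<equiv> D = 0 \<or> cinner (cblinfun_apply D x) x \<noteq> 0"

lemma good_scaleC: "c \<noteq> 0 \<Longrightarrow> good (c *\<^sub>C x) \<longleftrightarrow> good x"
  by (simp add: apply_scaleC cinner_simps)

lemma form_self_good:
  assumes "good x"
  shows "\<gamma> (rank1 x x) (rank1 x x) = 0"
proof (cases "x = 0")
  case False
  then obtain c u where u: "c \<noteq> 0" "norm u = 1" "x = c *\<^sub>C u" by (rule unit_multiple)
  have "good u" using assms unfolding u(3) good_scaleC[OF u(1)] .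
  from form_self[OF u(2) this] show ?thesis
    by (simp add: u rank1_scaleC_left rank1_scaleC_right scale_left scale_right)
qed (simp add: rank1_zero_left zero_left)

lemma eventually_good:
  assumes "good x"
  shows "\<forall>\<^sub>F s in at_right (0::real). good (x + complex_of_real s *\<^sub>C y)"
proof (cases "D = 0")
  case False
  have "((\<lambda>s. cinner (cblinfun_apply D x) x
      + complex_of_real s * (cinner (cblinfun_apply D x) y + cinner (cblinfun_apply D y) x)
      + complex_of_real s * complex_of_real s * cinner (cblinfun_apply D y) y)
    \<longlongrightarrow> cinner (cblinfun_apply D x) x
      + complex_of_real 0 * (cinner (cblinfun_apply D x) y + cinner (cblinfun_apply D y) x)
      + complex_of_real 0 * complex_of_real 0 * cinner (cblinfun_apply D y) y) (at_right (0::real))"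
    by (intro tendsto_intros)
  then have "\<forall>\<^sub>F s in at_right (0::real). cinner (cblinfun_apply D x) x
      + complex_of_real s * (cinner (cblinfun_apply D x) y + cinner (cblinfun_apply D y) x)
      + complex_of_real s * complex_of_real s * cinner (cblinfun_apply D y) y \<noteq> 0"
    by (rule tendsto_imp_eventually_ne) (use assms False in simp)
  then show ?thesis
    by (rule eventually_mono) (simp add: op_apply cinner_simps algebra_simps)
qed simp

text \<open>First-order term in \<open>s\<close> of the diagonal value of the form at
  \<open>x + s y\<close>: these vectors stay good for small positive \<open>s\<close>, so the
  resulting polynomial vanishes there and hence in its lowest coefficient.\<close>

lemma form_symmetrized:
  assumes "good x"
  shows "\<gamma> (rank1 x x) (rank1 x y + rank1 y x) = 0"
proof -
  define H where "H = rank1 x y + rank1 y x"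
  define K where "K = rank1 y y"
  define h where "h z = 2 * \<gamma> (rank1 x x) H + z * (2 * \<gamma> (rank1 x x) K + \<gamma> H H)
    + z * z * (2 * \<gamma> H K) + z * z * z * \<gamma> K K" for z :: complex
  have "\<forall>\<^sub>F s in at_right (0::real). h (complex_of_real s) = 0"
    using eventually_good[OF assms, of y] eventually_at_right_less[of 0]
  proof eventually_elim
    case (elim s)
    define z where "z = complex_of_real s"
    have z: "cnj z = z" "z \<noteq> 0" using elim by (simp_all add: z_def)
    have "rank1 (x + z *\<^sub>C y) (x + z *\<^sub>C y) = rank1 x x + z *\<^sub>C H + (z * z) *\<^sub>C K"
      by (simp add: rank1_add_left rank1_add_right rank1_scaleC_left rank1_scaleC_right z
          scaleC_simps H_def K_def)
    with form_self_good[OF elim(1)] form_self_good[OF assms] have "z * h z = 0"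
      by (simp add: form_simps h_def z_def[symmetric] sym[of H "rank1 x x"] sym[of K "rank1 x x"]
          sym[of K H] algebra_simps)
    with z show ?case by (simp add: z_def)
  qed
  then have "((\<lambda>s. h (complex_of_real s)) \<longlongrightarrow> 0) (at_right 0)"
    by (rule tendsto_eventually)
  moreover have "((\<lambda>s. h (complex_of_real s)) \<longlongrightarrow> h (complex_of_real 0)) (at_right 0)"
    unfolding h_def by (intro tendsto_intros)
  ultimately have "h (complex_of_real 0) = 0"
    using tendsto_unique[OF trivial_limit_at_right_real] by blast
  then show ?thesis by (simp add: h_def H_def)
qed

text \<open>Replacing \<open>y\<close> by \<open>\<i> *\<^sub>C y\<close> separates the summand
  linear in \<open>y\<close> from the conjugate-linear one.\<close>

lemma form_off_diagonal:
  assumes "good x"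
  shows "\<gamma> (rank1 x x) (rank1 x y) = 0" "\<gamma> (rank1 x x) (rank1 y x) = 0"
proof -
  have "\<gamma> (rank1 x x) (rank1 x y) + \<gamma> (rank1 x x) (rank1 y x) = 0"
    using form_symmetrized[OF assms, of y] by (simp add: form_simps)
  moreover have "\<i> * (\<gamma> (rank1 x x) (rank1 y x) - \<gamma> (rank1 x x) (rank1 x y)) = 0"
    using form_symmetrized[OF assms, of "\<i> *\<^sub>C y"]
    by (simp add: form_simps rank1_scaleC_left rank1_scaleC_right algebra_simps)
  ultimately show "\<gamma> (rank1 x x) (rank1 x y) = 0" "\<gamma> (rank1 x x) (rank1 y x) = 0"
    by simp_all
qed

text \<open>Peirce decomposition of \<open>B\<close> relative to the projection onto a unit vector:
  the corner orthogonal to it is covered by \<open>form_orthogonal\<close>, the other pieces have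
  rank one and fall under \<open>form_off_diagonal\<close>.\<close>

lemma form_good:
  assumes "good x"
  shows "\<gamma> B (rank1 x x) = 0"
proof -
  have unit: "\<gamma> B (rank1 u u) = 0" if u: "norm u = 1" "good u" for u
  proof -
    define Q where "Q = rank1 u u"
    define R where "R = cblinfun_id - Q"
    have QQ: "Q o\<^sub>C Q = Q"
      unfolding Q_def by (simp add: rank1_compose_rank1 cinner_self u scaleC_one)
    have RQ: "R o\<^sub>C Q = 0" "Q o\<^sub>C R = 0" by (simp_all add: R_def compose_simps QQ)
    have "\<gamma> (R o\<^sub>C B o\<^sub>C R) Q = 0"
      unfolding Q_def by (rule form_orthogonal[OF u])
        (simp_all add: RQ compose_assoc compose_zero_right flip: Q_def,
         simp add: RQ compose_zero_left flip: compose_assoc)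
    moreover have "\<gamma> (R o\<^sub>C (B o\<^sub>C Q)) Q = 0" "\<gamma> (Q o\<^sub>C B) Q = 0"
      unfolding Q_def compose_rank1 rank1_compose sym[of _ "rank1 u u"]
      by (rule form_off_diagonal[OF u(2)])+
    moreover have "B = Q o\<^sub>C B + R o\<^sub>C (B o\<^sub>C Q) + R o\<^sub>C B o\<^sub>C R"
      by (simp add: R_def compose_simps)
    ultimately show ?thesis by (metis Q_def add.right_neutral add_left)
  qed
  show ?thesis
  proof (cases "x = 0")
    case False
    then obtain c u where u: "c \<noteq> 0" "norm u = 1" "x = c *\<^sub>C u" by (rule unit_multiple)
    have "good u" using assms unfolding u(3) good_scaleC[OF u(1)] .
    from unit[OF u(2) this] show ?thesis
      by (simp add: u rank1_scaleC_left rank1_scaleC_right scale_right)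
  qed (simp add: rank1_zero_left zero_left sym[of B])
qed

lemma good_exists: "\<exists>u. good u"
proof (rule ccontr)
  assume "\<not> ?thesis"
  then have D: "D \<noteq> 0" and 0: "\<And>u. cinner (cblinfun_apply D u) u = 0" by blast+
  have "cinner (cblinfun_apply D x) y = 0" for x y
  proof -
    have "cinner (cblinfun_apply D x) y + cinner (cblinfun_apply D y) x = 0"
      using 0[of "x + y"] 0[of x] 0[of y] by (simp add: op_apply cinner_simps add.commute)
    moreover have "\<i> * (cinner (cblinfun_apply D y) x - cinner (cblinfun_apply D x) y) = 0"
      using 0[of "x + \<i> *\<^sub>C y"] 0[of x] 0[of y]
      by (simp add: op_apply cinner_simps algebra_simps)
    ultimately show ?thesis by simp
  qed
  then have "D = 0" by (intro cblinfun_eq_cinnerI) (simp add: op_apply)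
  with D show False by blast
qed

text \<open>Density of the good vectors: at a bad \<open>x\<close> the diagonal coefficient of
  \<open>D\<close> along the line is s (b + s c) with c non-zero.\<close>

lemma eventually_good':
  assumes "good u"
  shows "\<forall>\<^sub>F s in at_right (0::real). good (x + complex_of_real s *\<^sub>C u)"
proof (cases "good x")
  case True
  then show ?thesis by (rule eventually_good)
next
  case False
  define b where "b = cinner (cblinfun_apply D x) u + cinner (cblinfun_apply D u) x"
  define c where "c = cinner (cblinfun_apply D u) u"
  have c: "c \<noteq> 0" using assms False by (simp add: c_def)
  have eq: "cinner (cblinfun_apply D (x + z *\<^sub>C u)) (x + z *\<^sub>C u) = z * (b + z * c)"
    if "cnj z = z" for z
    using False that by (simp add: op_apply cinner_simps b_def c_def algebra_simps)
  have "\<forall>\<^sub>F s in at_right (0::real). b + complex_of_real s * c \<noteq> 0"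
  proof (cases "b = 0")
    case True
    then show ?thesis
      using c by (intro eventually_mono[OF eventually_at_right_less[of 0]]) auto
  next
    case False
    have "((\<lambda>s. b + complex_of_real s * c) \<longlongrightarrow> b + complex_of_real 0 * c) (at_right 0)"
      by (intro tendsto_intros)
    then show ?thesis by (rule tendsto_imp_eventually_ne) (use False in simp)
  qed
  with eventually_at_right_less[of 0] show ?thesis
    by eventually_elim (simp add: eq)
qed

lemma form_rank1: "\<gamma> B (rank1 x y) = 0"
proof -
  have self: "\<gamma> B (rank1 x x) = 0" for x
  proof -
    obtain u where u: "good u" using good_exists by blast
    \<comment> \<open>A polynomial that vanishes for small positive parameters, where the perturbed
      vector is good; its constant term is the value sought.\<close>
    define h where "h z = \<gamma> B (rank1 x x) + z * \<gamma> B (rank1 x u + rank1 u x) + z * z * \<gamma> B (rank1 u u)"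
      for z :: complex
    have "\<forall>\<^sub>F s in at_right (0::real). h (complex_of_real s) = 0"
      using eventually_good'[OF u]
      by (rule eventually_mono) (drule form_good[where B = B],
        simp add: h_def rank1_add_left rank1_add_right rank1_scaleC_left rank1_scaleC_right
          form_simps algebra_simps)
    then have "((\<lambda>s. h (complex_of_real s)) \<longlongrightarrow> 0) (at_right 0)"
      by (rule tendsto_eventually)
    moreover have "((\<lambda>s. h (complex_of_real s)) \<longlongrightarrow> h (complex_of_real 0)) (at_right 0)"
      unfolding h_def by (intro tendsto_intros)
    ultimately have "h (complex_of_real 0) = 0"
      using tendsto_unique[OF trivial_limit_at_right_real] by blast
    then show ?thesis by (simp add: h_def)
  qed
  show ?thesis by (subst rank1_polarization) (simp add: form_simps self)
qed

end

section \<open>Operators of finite rank\<close>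

definition finite_rank :: "('a::complex_inner, 'b::complex_inner) cblinfun set"
  where "finite_rank = complex_vector.span (range (\<lambda>(y, z). rank1 y z))"

lemma rank1_finite_rank [simp]: "rank1 y z \<in> finite_rank"
  unfolding finite_rank_def by (rule complex_vector.span_base) force

lemma finite_rank_induct [consumes 1, case_names zero add rank1]:
  assumes "F \<in> finite_rank" "P 0" "\<And>F G. P F \<Longrightarrow> P G \<Longrightarrow> P (F + G)"
    "\<And>c y z. P (c *\<^sub>C rank1 y z)"
  shows "P F"
  using assms(1) unfolding finite_rank_def
proof (induction rule: complex_vector.span_induct_alt)
  case (step c F G)
  then obtain y z where "F = rank1 y z" by auto
  then show ?case by (simp add: assms(3,4) step.IH)
qed (rule assms(2))

lemma finite_rank_add: "F \<in> finite_rank \<Longrightarrow> G \<in> finite_rank \<Longrightarrow> F + G \<in> finite_rank"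
  unfolding finite_rank_def by (rule complex_vector.span_add)

lemma finite_rank_scaleC: "F \<in> finite_rank \<Longrightarrow> c *\<^sub>C F \<in> finite_rank"
  unfolding finite_rank_def by (rule complex_vector.span_scale)

lemma finite_rank_zero: "0 \<in> finite_rank"
  unfolding finite_rank_def by (rule complex_vector.span_zero)

lemma finite_rank_compose:
  fixes A F :: "('a::chilbert_space, 'a) cblinfun"
  assumes "F \<in> finite_rank"
  shows "A o\<^sub>C F \<in> finite_rank \<and> F o\<^sub>C A \<in> finite_rank"
  using assms
  by (induction rule: finite_rank_induct)
    (simp_all add: compose_simps compose_rank1 rank1_compose finite_rank_zero
      finite_rank_add finite_rank_scaleC)

lemma finite_rank_jordan:
  fixes A F :: "('a::chilbert_space, 'a) cblinfun"
  shows "F \<in> finite_rank \<Longrightarrow> A \<circ>\<^sub>J F \<in> finite_rank"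
  by (simp add: jordan_product_def finite_rank_add finite_rank_compose)

text \<open>\<open>Z y\<close> is orthogonal to everything orthogonal to \<open>y\<close>, so every
  vector is an eigenvector, and the eigenvalues at orthogonal non-zero vectors agree because their
  sum is an eigenvector too.\<close>

lemma scalar_if_orthogonality_preserving:
  fixes Z :: "('b::complex_inner, 'b) cblinfun"
  assumes orth: "\<And>y q. cinner y q = 0 \<Longrightarrow> cinner (cblinfun_apply Z y) q = 0"
  shows "\<exists>c. Z = c *\<^sub>C cblinfun_id"
proof (cases "\<exists>x :: 'b. x \<noteq> 0")
  case False
  then have "Z = 0 *\<^sub>C cblinfun_id" by (intro cblinfun_eqI) metis
  then show ?thesis by blast
next
  case True
  have "\<exists>c. cblinfun_apply Z y = c *\<^sub>C y" for y
  proof (cases "y = 0")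
    case False
    define c where "c = cinner (cblinfun_apply Z y) y / cinner y y"
    define q where "q = cblinfun_apply Z y - c *\<^sub>C y"
    have "cinner q y = 0" using False by (simp add: q_def c_def cinner_simps)
    then have yq: "cinner y q = 0" by (simp add: cinner_eq_0_sym)
    have "cinner q q = cinner (cblinfun_apply Z y) q - c * cinner y q"
      by (subst (1) q_def) (simp only: cinner_simps)
    then have "cinner q q = 0" by (simp add: yq orth)
    then show ?thesis by (auto simp: q_def)
  qed simp
  then obtain c where c: "\<And>y. cblinfun_apply Z y = c y *\<^sub>C y" by metis
  obtain x :: 'b where x: "x \<noteq> 0" using True by blast
  have "cblinfun_apply Z y = c x *\<^sub>C y" for y
  proof -
    define y' where "y' = y - (cinner y x / cinner x x) *\<^sub>C x"
    have y'x: "cinner y' x = 0" using x by (simp add: y'_def cinner_simps)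
    then have xy': "cinner x y' = 0" by (simp add: cinner_eq_0_sym)
    have eq: "c x *\<^sub>C x + c y' *\<^sub>C y' = c (x + y') *\<^sub>C (x + y')"
      using c[of x] c[of y'] c[of "x + y'"] by (simp add: apply_add)
    have "c x = c (x + y')"
      using arg_cong[OF eq, of "\<lambda>w. cinner w x"] x by (simp add: cinner_simps y'x)
    moreover have "y' = 0 \<or> c y' = c (x + y')"
      using arg_cong[OF eq, of "\<lambda>w. cinner w y'"] by (simp add: cinner_simps xy')
    ultimately have "cblinfun_apply Z y' = c x *\<^sub>C y'" using c[of y'] by auto
    moreover have "y = y' + (cinner y x / cinner x x) *\<^sub>C x" by (simp add: y'_def)
    ultimately show ?thesis using c[of x]
      by (metis apply_add apply_scaleC mult.commute scaleC_add_right scaleC_scaleC)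
  qed
  then have "Z = c x *\<^sub>C cblinfun_id" by (intro cblinfun_eqI) (simp add: op_apply)
  then show ?thesis by blast
qed

section \<open>The image of the identity\<close>

lemma add_self_cancel: "A + A = B + B \<Longrightarrow> A = (B :: 'c::real_vector)"
  by (metis scaleR_2 scaleR_cancel_left zero_neq_numeral)

text \<open>\<open>T\<close> commutes with its square, which forces \<open>Z\<close> to commute with
  the square of \<open>T\<close>; then \<open>Z\<close> commutes with
  \<open>Z o\<^sub>C T + T o\<^sub>C Z\<close>, and the mixed terms cancel.\<close>

lemma commute_of_square:
  assumes "T o\<^sub>C T + T o\<^sub>C T = Z o\<^sub>C T + T o\<^sub>C Z"
  shows "Z o\<^sub>C Z o\<^sub>C T = T o\<^sub>C (Z o\<^sub>C Z)"
proof -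
  have "T o\<^sub>C (Z o\<^sub>C T + T o\<^sub>C Z) = (Z o\<^sub>C T + T o\<^sub>C Z) o\<^sub>C T"
    unfolding assms[symmetric] by (simp add: compose_simps)
  then have "T o\<^sub>C T o\<^sub>C Z = Z o\<^sub>C (T o\<^sub>C T)" by (simp add: compose_simps)
  then have "Z o\<^sub>C (T o\<^sub>C T + T o\<^sub>C T) = (T o\<^sub>C T + T o\<^sub>C T) o\<^sub>C Z" by (simp add: compose_simps)
  then show ?thesis unfolding assms by (simp add: compose_simps)
qed

locale scaled_jordan_map =
  fixes \<Psi> :: "('a::chilbert_space, 'a) cblinfun \<Rightarrow> ('b::chilbert_space, 'b) cblinfun"
    and Z :: "('b, 'b) cblinfun"
  assumes map_add: "\<Psi> (A + B) = \<Psi> A + \<Psi> B"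
    and map_scale: "\<Psi> (c *\<^sub>C A) = c *\<^sub>C \<Psi> A"
    and bij: "bij \<Psi>"
    and map_id: "\<Psi> cblinfun_id = Z"
    and mult_rank1: "\<Psi> B \<circ>\<^sub>J \<Psi> (rank1 x y) + \<Psi> B \<circ>\<^sub>J \<Psi> (rank1 x y) = Z \<circ>\<^sub>J \<Psi> (B \<circ>\<^sub>J rank1 x y)"
begin

lemma map_zero: "\<Psi> 0 = 0"
  using map_add[of 0 0] by simp

lemma map_diff: "\<Psi> (A - B) = \<Psi> A - \<Psi> B"
  using map_add[of "A - B" B] by simp

lemma mult:
  assumes "F \<in> finite_rank"
  shows "\<Psi> B \<circ>\<^sub>J \<Psi> F + \<Psi> B \<circ>\<^sub>J \<Psi> F = Z \<circ>\<^sub>J \<Psi> (B \<circ>\<^sub>J F)"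
  using assms
proof (induction rule: finite_rank_induct)
  case zero
  then show ?case by (simp add: jordan_zero_right map_zero)
next
  case (add F G)
  have "\<Psi> B \<circ>\<^sub>J \<Psi> (F + G) + \<Psi> B \<circ>\<^sub>J \<Psi> (F + G)
      = (\<Psi> B \<circ>\<^sub>J \<Psi> F + \<Psi> B \<circ>\<^sub>J \<Psi> F) + (\<Psi> B \<circ>\<^sub>J \<Psi> G + \<Psi> B \<circ>\<^sub>J \<Psi> G)"
    by (simp add: map_add jordan_add_right add_ac)
  then show ?case by (simp add: add.IH map_add jordan_add_right)
next
  case (rank1 c y z)
  show ?case
    unfolding map_scale jordan_scaleC_right scaleC_add_right[symmetric] mult_rank1 ..
qed

text \<open>For a projection onto a unit vector, idempotency gives its image \<open>T\<close> the
  relation required by \<open>commute_of_square\<close>; polarization and linearity do the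
  rest.\<close>

lemma square_commute:
  assumes "F \<in> finite_rank"
  shows "Z o\<^sub>C Z o\<^sub>C \<Psi> F = \<Psi> F o\<^sub>C (Z o\<^sub>C Z)"
proof -
  have unit: "Z o\<^sub>C Z o\<^sub>C \<Psi> (rank1 x x) = \<Psi> (rank1 x x) o\<^sub>C (Z o\<^sub>C Z)" if "norm x = 1" for x
  proof (rule commute_of_square)
    define T where "T = \<Psi> (rank1 x x)"
    have "rank1 x x \<circ>\<^sub>J rank1 x x = rank1 x x + rank1 x x"
      using that by (simp add: jordan_product_def rank1_compose_rank1 cinner_self scaleC_one)
    then have "T \<circ>\<^sub>J T + T \<circ>\<^sub>J T = Z \<circ>\<^sub>J T + Z \<circ>\<^sub>J T"
      using mult_rank1[of "rank1 x x" x x] by (simp add: T_def map_add jordan_simps)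
    then show "\<Psi> (rank1 x x) o\<^sub>C \<Psi> (rank1 x x) + \<Psi> (rank1 x x) o\<^sub>C \<Psi> (rank1 x x)
        = Z o\<^sub>C \<Psi> (rank1 x x) + \<Psi> (rank1 x x) o\<^sub>C Z"
      using add_self_cancel unfolding jordan_product_def T_def by blast
  qed
  have self: "Z o\<^sub>C Z o\<^sub>C \<Psi> (rank1 x x) = \<Psi> (rank1 x x) o\<^sub>C (Z o\<^sub>C Z)" for x
  proof (cases "x = 0")
    case False
    then obtain c u where "norm u = 1" and x: "x = c *\<^sub>C u" by (rule unit_multiple)
    from unit[OF this(1)] show ?thesis
      unfolding x rank1_scaleC_left rank1_scaleC_right map_scale compose_scaleC_left
        compose_scaleC_right by simp
  qed (simp add: rank1_zero_left map_zero compose_simps)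
  have "Z o\<^sub>C Z o\<^sub>C \<Psi> (rank1 x y) = \<Psi> (rank1 x y) o\<^sub>C (Z o\<^sub>C Z)" for x y
    unfolding rank1_polarization[of x y] map_add map_diff map_scale compose_add_left compose_add_right
      compose_diff_left compose_diff_right compose_scaleC_left compose_scaleC_right self ..
  with assms show ?thesis
    by (induction rule: finite_rank_induct) (simp_all add: map_add map_zero map_scale compose_simps)
qed

text \<open>With a preimage \<open>E\<close> of the identity, the image of \<open>F\<close> is a
  multiple of \<open>Z \<circ>\<^sub>J S\<close>, where \<open>S\<close> commutes with the square of
  \<open>Z\<close>; such a Jordan product commutes with \<open>Z\<close>.\<close>

lemma commute:
  assumes "F \<in> finite_rank"
  shows "Z o\<^sub>C \<Psi> F = \<Psi> F o\<^sub>C Z"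
proof -
  obtain E where E: "\<Psi> E = cblinfun_id" using bij by (metis bij_pointE)
  define S where "S = \<Psi> (E \<circ>\<^sub>J F)"
  have "Z o\<^sub>C Z o\<^sub>C S = S o\<^sub>C (Z o\<^sub>C Z)"
    unfolding S_def using assms by (intro square_commute finite_rank_jordan)
  then have "Z o\<^sub>C (Z \<circ>\<^sub>J S) = (Z \<circ>\<^sub>J S) o\<^sub>C Z" by (simp add: jordan_product_def compose_simps)
  moreover have "\<Psi> F + \<Psi> F + (\<Psi> F + \<Psi> F) = Z \<circ>\<^sub>J S"
    using mult[OF assms, of E] by (simp add: E S_def jordan_simps)
  ultimately have "(Z o\<^sub>C \<Psi> F + Z o\<^sub>C \<Psi> F) + (Z o\<^sub>C \<Psi> F + Z o\<^sub>C \<Psi> F)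
      = (\<Psi> F o\<^sub>C Z + \<Psi> F o\<^sub>C Z) + (\<Psi> F o\<^sub>C Z + \<Psi> F o\<^sub>C Z)"
    by (metis compose_add_left compose_add_right)
  then show ?thesis by (blast dest: add_self_cancel)
qed

text \<open>Surjectivity makes \<open>S\<close> arbitrary, so commutation with \<open>Z\<close> can
  be tested on operators of rank one.\<close>

lemma commute_jordan:
  assumes "F \<in> finite_rank"
  shows "Z o\<^sub>C (S \<circ>\<^sub>J \<Psi> F) = (S \<circ>\<^sub>J \<Psi> F) o\<^sub>C Z"
proof -
  obtain B where B: "\<Psi> B = S" using bij by (metis bij_pointE)
  define W where "W = \<Psi> (B \<circ>\<^sub>J F)"
  have "Z o\<^sub>C W = W o\<^sub>C Z"
    unfolding W_def using assms by (intro commute finite_rank_jordan)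
  moreover from this have "Z o\<^sub>C (W o\<^sub>C Z) = W o\<^sub>C (Z o\<^sub>C Z)" by (metis compose_assoc)
  ultimately have "Z o\<^sub>C (Z \<circ>\<^sub>J W) = (Z \<circ>\<^sub>J W) o\<^sub>C Z" by (simp add: jordan_product_def compose_simps)
  moreover have "S \<circ>\<^sub>J \<Psi> F + S \<circ>\<^sub>J \<Psi> F = Z \<circ>\<^sub>J W" using mult[OF assms, of B] by (simp add: B W_def)
  ultimately show ?thesis by (metis compose_add_left compose_add_right add_self_cancel)
qed

text \<open>A non-scalar \<open>Z\<close> would force all finite-rank operators to commute with each
  other, contradicted by \<open>rank1 x x\<close> and \<open>rank1 x y\<close>; injectivity makes
  the scalar non-zero.\<close>

lemma scalar:
  fixes x y :: 'a
  assumes x: "x \<noteq> 0" and y: "y \<noteq> 0" and xy: "cinner x y = 0"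
  shows "\<exists>c. c \<noteq> 0 \<and> Z = c *\<^sub>C cblinfun_id"
proof -
  have "\<exists>c. Z = c *\<^sub>C cblinfun_id"
  proof (rule ccontr)
    assume "\<not> ?thesis"
    then obtain w q where wq: "cinner w q = 0" and Zwq: "cinner (cblinfun_apply Z w) q \<noteq> 0"
      using scalar_if_orthogonality_preserving by blast
    obtain E where E: "\<Psi> E = cblinfun_id" using bij by (metis bij_pointE)
    \<comment> \<open>Commuting rank-one test operators \<open>S\<close> with \<open>Z\<close> puts the image of every
      finite-rank operator into the span of \<open>Z\<close> and the identity.\<close>
    have span: "\<exists>a b. F = a *\<^sub>C cblinfun_id + b *\<^sub>C E" if F: "F \<in> finite_rank" for F
    proof -
      define c where "c = cinner (cblinfun_apply Z w) q"
      define a where "a = cinner (cblinfun_apply (\<Psi> F) w) q / c"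
      define b where "b = - cinner (cblinfun_apply (\<Psi> F) (cblinfun_apply Z w)) q / c"
      have "cblinfun_apply (\<Psi> F) p = a *\<^sub>C cblinfun_apply Z p + b *\<^sub>C p" for p
      proof -
        have "cblinfun_apply (Z o\<^sub>C (rank1 p q \<circ>\<^sub>J \<Psi> F)) w = cblinfun_apply ((rank1 p q \<circ>\<^sub>J \<Psi> F) o\<^sub>C Z) w"
          using commute_jordan[OF F] by simp
        then have "c *\<^sub>C cblinfun_apply (\<Psi> F) p = (a * c) *\<^sub>C cblinfun_apply Z p + (b * c) *\<^sub>C p"
          using Zwq by (simp add: op_apply rank1_apply wq a_def b_def c_def)
        then have "inverse c *\<^sub>C c *\<^sub>C cblinfun_apply (\<Psi> F) p
            = inverse c *\<^sub>C ((a * c) *\<^sub>C cblinfun_apply Z p + (b * c) *\<^sub>C p)" by simp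
        moreover have "c \<noteq> 0" using Zwq by (simp add: c_def)
        moreover from this have "inverse c * (t * c) = t" for t by simp
        ultimately show ?thesis by (simp add: scaleC_simps)
      qed
      then have "\<Psi> F = a *\<^sub>C Z + b *\<^sub>C cblinfun_id" by (intro cblinfun_eqI) (simp add: op_apply)
      also have "\<dots> = \<Psi> (a *\<^sub>C cblinfun_id + b *\<^sub>C E)" by (simp add: map_add map_scale map_id E)
      finally have "F = a *\<^sub>C cblinfun_id + b *\<^sub>C E" using bij by (simp add: bij_is_inj inj_eq)
      then show ?thesis by blast
    qed
    have "F o\<^sub>C G = G o\<^sub>C F" if FG: "F \<in> finite_rank" "G \<in> finite_rank" for F G :: "('a, 'a) cblinfun"
    proof -
      obtain a b a' b' where "F = a *\<^sub>C cblinfun_id + b *\<^sub>C E" "G = a' *\<^sub>C cblinfun_id + b' *\<^sub>C E"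
        using span[OF FG(1)] span[OF FG(2)] by blast
      then show ?thesis by (simp add: compose_simps scaleC_simps mult.commute add_ac)
    qed
    then have "rank1 x x o\<^sub>C rank1 x y = rank1 x y o\<^sub>C rank1 x x" by simp
    then show False using x y xy by (simp add: rank1_compose_rank1 rank1_eq_0_iff)
  qed
  then obtain c where c: "Z = c *\<^sub>C cblinfun_id" by blast
  have "cblinfun_id \<noteq> (0 :: ('a, 'a) cblinfun)"
    using x by (metis cblinfun_id.rep_eq zero_cblinfun.rep_eq)
  then have "Z \<noteq> 0" using map_id map_zero bij by (metis bij_is_inj inj_eq)
  with c show ?thesis by auto
qed

end

section \<open>Unital maps that are Jordan multiplicative against finite-rank operators\<close>

locale unital_jordan_map =
  fixes \<Phi> :: "('a::chilbert_space, 'a) cblinfun \<Rightarrow> ('b::chilbert_space, 'b) cblinfun"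
  assumes map_add: "\<Phi> (A + B) = \<Phi> A + \<Phi> B"
    and map_scale: "\<Phi> (c *\<^sub>C A) = c *\<^sub>C \<Phi> A"
    and bij: "bij \<Phi>"
    and map_id: "\<Phi> cblinfun_id = cblinfun_id"
    and mult: "F \<in> finite_rank \<Longrightarrow> \<Phi> (B \<circ>\<^sub>J F) = \<Phi> B \<circ>\<^sub>J \<Phi> F"
begin

lemma map_zero: "\<Phi> 0 = 0"
  using map_add[of 0 0] by simp

lemma map_diff: "\<Phi> (A - B) = \<Phi> A - \<Phi> B"
  using map_add[of "A - B" B] by simp

lemma map_eq_0_iff: "\<Phi> A = 0 \<longleftrightarrow> A = 0"
  using bij map_zero by (metis bij_is_inj inj_eq)

lemma map_square:
  assumes "F \<in> finite_rank"
  shows "\<Phi> (F o\<^sub>C F) = \<Phi> F o\<^sub>C \<Phi> F"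
  using mult[OF assms, of F] unfolding jordan_product_def map_add by (rule add_self_cancel)

lemma map_triple:
  assumes F: "F \<in> finite_rank"
  shows "\<Phi> (F o\<^sub>C B o\<^sub>C F) = \<Phi> F o\<^sub>C \<Phi> B o\<^sub>C \<Phi> F"
proof -
  have *: "S o\<^sub>C T o\<^sub>C S + S o\<^sub>C T o\<^sub>C S = T \<circ>\<^sub>J S \<circ>\<^sub>J S - T \<circ>\<^sub>J (S o\<^sub>C S)"
    for S T :: "('c::complex_inner, 'c) cblinfun"
    by (simp add: jordan_product_def compose_simps)
  have FF: "F o\<^sub>C F \<in> finite_rank" using F by (simp add: finite_rank_compose)
  have "\<Phi> (F o\<^sub>C B o\<^sub>C F) + \<Phi> (F o\<^sub>C B o\<^sub>C F) = \<Phi> (B \<circ>\<^sub>J F \<circ>\<^sub>J F - B \<circ>\<^sub>J (F o\<^sub>C F))"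
    unfolding map_add[symmetric] * ..
  also have "\<dots> = \<Phi> B \<circ>\<^sub>J \<Phi> F \<circ>\<^sub>J \<Phi> F - \<Phi> B \<circ>\<^sub>J (\<Phi> F o\<^sub>C \<Phi> F)"
    by (simp add: map_diff mult F FF map_square)
  also have "\<dots> = \<Phi> F o\<^sub>C \<Phi> B o\<^sub>C \<Phi> F + \<Phi> F o\<^sub>C \<Phi> B o\<^sub>C \<Phi> F"
    unfolding * ..
  finally show ?thesis by (rule add_self_cancel)
qed

lemma map_sandwich:
  "\<Phi> (rank1 x y) o\<^sub>C \<Phi> B o\<^sub>C \<Phi> (rank1 x y) = cinner (cblinfun_apply B x) y *\<^sub>C \<Phi> (rank1 x y)"
  by (simp flip: map_triple map_scale add: rank1_sandwich)

lemma map_projection_rank1: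
  assumes x: "norm x = 1"
  shows "\<exists>u v. \<Phi> (rank1 x x) = rank1 u v \<and> cinner u v = 1"
proof -
  define T where "T = \<Phi> (rank1 x x)"
  have "x \<noteq> 0" using x by auto
  then have "T \<noteq> 0" by (simp add: T_def map_eq_0_iff rank1_eq_0_iff)
  then obtain w where w: "cblinfun_apply T w \<noteq> 0"
    by (metis cblinfun_eqI zero_cblinfun.rep_eq)
  have "rank1 x x o\<^sub>C rank1 x x = rank1 x x"
    by (simp add: rank1_compose_rank1 cinner_self x scaleC_one)
  then have TT: "T o\<^sub>C T = T" using map_square[of "rank1 x x"] by (simp add: T_def)
  define u where "u = cblinfun_apply T w"
  have u: "cinner u u \<noteq> 0" using w by (simp add: u_def)
  have Tu: "cblinfun_apply T u = u"
    using arg_cong[OF TT, of "\<lambda>A. cblinfun_apply A w"] by (simp add: u_def op_apply)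
  define v where "v = (1 / cinner u u) *\<^sub>C cblinfun_apply (cadjoint T) u"
  have cc: "cnj (cinner u u) = cinner u u" by (metis cinner_commute)
  have "cblinfun_apply T p = cinner p v *\<^sub>C u" for p
  proof -
    obtain B where B: "\<Phi> B = rank1 p u" using bij by (metis bij_pointE)
    define c where "c = cinner (cblinfun_apply B x) x"
    have "T o\<^sub>C rank1 p u o\<^sub>C T = c *\<^sub>C T" using map_sandwich[of x x B] by (simp add: B T_def c_def)
    then have "cblinfun_apply (T o\<^sub>C rank1 p u o\<^sub>C T) u = c *\<^sub>C u" by (simp add: op_apply Tu)
    then have *: "cinner u u *\<^sub>C cblinfun_apply T p = c *\<^sub>C u" by (simp add: op_apply Tu rank1_apply)
    then have "cinner (cinner u u *\<^sub>C cblinfun_apply T p) u = cinner (c *\<^sub>C u) u" by simp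
    then have "c = cinner (cblinfun_apply T p) u" using u by (simp add: cinner_simps)
    then have c: "c / cinner u u = cinner p v"
      by (simp add: v_def cinner_simps cinner_adjoint_right cc)
    have "cblinfun_apply T p = (1 / cinner u u) *\<^sub>C cinner u u *\<^sub>C cblinfun_apply T p"
      using u by (simp add: scaleC_simps)
    also have "\<dots> = (c / cinner u u) *\<^sub>C u" unfolding * by (simp add: scaleC_simps)
    finally show ?thesis by (simp add: c)
  qed
  then have "T = rank1 u v" by (intro cblinfun_eqI) (simp add: rank1_apply)
  moreover have "cinner u v = 1"
    using u by (simp add: v_def cinner_simps cinner_adjoint_right cc Tu)
  ultimately show ?thesis unfolding T_def by blast
qed

end

locale based_jordan_map = unital_jordan_map +
  fixes x u v
  assumes x: "norm x = 1"
    and base: "\<Phi> (rank1 x x) = rank1 u v"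
    and uv: "cinner u v = 1"
begin

lemma xx: "cinner x x = 1"
  by (simp add: cinner_self x)

lemma u_nonzero: "u \<noteq> 0"
  using uv by auto

lemma corner: "cinner (cblinfun_apply (\<Phi> B) u) v = cinner (cblinfun_apply B x) x"
proof -
  have "cinner (cblinfun_apply (\<Phi> B) u) v *\<^sub>C rank1 u v = cinner (cblinfun_apply B x) x *\<^sub>C rank1 u v"
    using map_sandwich[of x x B] by (simp add: base rank1_sandwich)
  from arg_cong[OF this, of "\<lambda>A. cinner (cblinfun_apply A u) v"]
  show ?thesis by (simp add: op_apply rank1_apply cinner_simps uv)
qed

lemma off_diagonal:
  assumes "F \<in> finite_rank" "rank1 x x \<circ>\<^sub>J F = F" "F o\<^sub>C F = 0"
  shows off_diagonal_split: "cblinfun_apply (\<Phi> F) w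
      = cinner (cblinfun_apply (\<Phi> F) w) v *\<^sub>C u + cinner w v *\<^sub>C cblinfun_apply (\<Phi> F) u"
    and off_diagonal_cases: "cblinfun_apply (\<Phi> F) u = 0 \<or> (\<forall>w. cinner (cblinfun_apply (\<Phi> F) w) v = 0)"
proof -
  define S where "S = \<Phi> F"
  have split: "rank1 u v \<circ>\<^sub>J S = S"
    using mult[OF assms(1), of "rank1 x x"] by (simp add: assms(2) base S_def)
  have split': "cblinfun_apply S w = cinner (cblinfun_apply S w) v *\<^sub>C u + cinner w v *\<^sub>C cblinfun_apply S u" for w
    using arg_cong[OF split, of "\<lambda>A. cblinfun_apply A w"] by (simp add: op_apply rank1_apply)
  then show "cblinfun_apply (\<Phi> F) w
      = cinner (cblinfun_apply (\<Phi> F) w) v *\<^sub>C u + cinner w v *\<^sub>C cblinfun_apply (\<Phi> F) u"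
    unfolding S_def .
  have SS: "cblinfun_apply S (cblinfun_apply S w) = 0" for w
    using arg_cong[OF map_square[OF assms(1)], of "\<lambda>A. cblinfun_apply A w"]
    by (simp add: assms(3) map_zero S_def op_apply)
  have "cinner (cblinfun_apply S w) v *\<^sub>C cblinfun_apply S u = 0" for w
    using arg_cong[OF split'[of w], of "cblinfun_apply S"] by (simp add: SS op_apply)
  then show "cblinfun_apply (\<Phi> F) u = 0 \<or> (\<forall>w. cinner (cblinfun_apply (\<Phi> F) w) v = 0)"
    unfolding S_def[symmetric] by (metis complex_vector.scale_eq_0_iff)
qed

lemma off_diagonal_rank1:
  assumes "cinner y x = 0"
  shows "rank1 x x \<circ>\<^sub>J rank1 x y = rank1 x y" "rank1 x y o\<^sub>C rank1 x y = 0"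
    "rank1 x x \<circ>\<^sub>J rank1 y x = rank1 y x" "rank1 y x o\<^sub>C rank1 y x = 0"
  using assms cinner_eq_0_sym[of x y]
  by (simp_all add: jordan_product_def rank1_compose_rank1 xx scaleC_one)

lemma row:
  assumes "cinner y x = 0"
  shows row_split: "cblinfun_apply (\<Phi> (rank1 x y)) w
      = cinner (cblinfun_apply (\<Phi> (rank1 x y)) w) v *\<^sub>C u + cinner w v *\<^sub>C cblinfun_apply (\<Phi> (rank1 x y)) u"
    and row_cases: "cblinfun_apply (\<Phi> (rank1 x y)) u = 0
      \<or> (\<forall>w. cinner (cblinfun_apply (\<Phi> (rank1 x y)) w) v = 0)"
  using off_diagonal[OF rank1_finite_rank] off_diagonal_rank1(1,2)[OF assms] by blast+

lemma column:
  assumes "cinner y x = 0"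
  shows column_split: "cblinfun_apply (\<Phi> (rank1 y x)) w
      = cinner (cblinfun_apply (\<Phi> (rank1 y x)) w) v *\<^sub>C u + cinner w v *\<^sub>C cblinfun_apply (\<Phi> (rank1 y x)) u"
    and column_cases: "cblinfun_apply (\<Phi> (rank1 y x)) u = 0
      \<or> (\<forall>w. cinner (cblinfun_apply (\<Phi> (rank1 y x)) w) v = 0)"
  using off_diagonal[OF rank1_finite_rank] off_diagonal_rank1(3,4)[OF assms] by blast+

lemma row_column:
  assumes "cinner y x = 0"
  shows "cinner (cblinfun_apply (\<Phi> (rank1 x y)) (cblinfun_apply (\<Phi> (rank1 y x)) u)) v
    + cinner (cblinfun_apply (\<Phi> (rank1 y x)) (cblinfun_apply (\<Phi> (rank1 x y)) u)) v = cinner y y"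
  using corner[of "rank1 x y \<circ>\<^sub>J rank1 y x"] assms cinner_eq_0_sym[of x y]
  by (simp add: mult jordan_apply op_apply rank1_apply cinner_simps xx)

lemma map_rank1_add_right: "\<Phi> (rank1 x (y + z)) = \<Phi> (rank1 x y) + \<Phi> (rank1 x z)"
  by (simp add: rank1_add_right map_add)

lemma dichotomy:
  "(\<forall>y. cinner y x = 0 \<longrightarrow> cblinfun_apply (\<Phi> (rank1 x y)) u = 0)
    \<or> (\<forall>y. cinner y x = 0 \<longrightarrow> cblinfun_apply (\<Phi> (rank1 y x)) u = 0)"
proof (cases "\<forall>y. cinner y x = 0 \<longrightarrow> cblinfun_apply (\<Phi> (rank1 x y)) u = 0")
  case False
  then obtain z where z: "cinner z x = 0" and zu: "cblinfun_apply (\<Phi> (rank1 x z)) u \<noteq> 0" by blast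
  show ?thesis
  proof (intro disjI2 allI impI)
    fix y assume y: "cinner y x = 0"
    have z0: "cinner (cblinfun_apply (\<Phi> (rank1 x z)) w) v = 0" for w
      using row_cases[OF z] zu by blast
    have y0: "cinner (cblinfun_apply (\<Phi> (rank1 x y)) w) v = 0" for w
    proof (rule ccontr)
      assume ne: "\<not> ?thesis"
      then have "cblinfun_apply (\<Phi> (rank1 x y)) u = 0" using row_cases[OF y] by blast
      then have "cblinfun_apply (\<Phi> (rank1 x (y + z))) u \<noteq> 0"
        using zu by (simp add: map_rank1_add_right op_apply)
      moreover have "cinner (y + z) x = 0" using y z by (simp add: cinner_simps)
      ultimately have "cinner (cblinfun_apply (\<Phi> (rank1 x (y + z))) w) v = 0"
        using row_cases by blast
      with ne z0 show False by (simp add: map_rank1_add_right op_apply cinner_simps)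
    qed
    show "cblinfun_apply (\<Phi> (rank1 y x)) u = 0"
    proof (cases "y = 0")
      case False
      then have "cinner (cblinfun_apply (\<Phi> (rank1 y x)) (cblinfun_apply (\<Phi> (rank1 x y)) u)) v \<noteq> 0"
        using row_column[OF y] y0 by simp
      then show ?thesis using column_cases[OF y] by blast
    qed (simp add: rank1_zero_left map_zero op_apply)
  qed
qed blast

lemma spatial:
  assumes row: "\<And>y. cinner y x = 0 \<Longrightarrow> cblinfun_apply (\<Phi> (rank1 x y)) u = 0"
  shows "\<exists>U U_inv. U_inv o\<^sub>C U = cblinfun_id \<and> U o\<^sub>C U_inv = cblinfun_id \<and>
    (\<forall>A. \<Phi> A = U o\<^sub>C A o\<^sub>C U_inv)"
proof -
  have column: "cinner (cblinfun_apply (\<Phi> (rank1 y x)) w) v = 0" if y: "cinner y x = 0" for y w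
  proof (cases "y = 0")
    case False
    then have "cblinfun_apply (\<Phi> (rank1 y x)) u \<noteq> 0"
      using row_column[OF y] row[OF y] by auto
    then show ?thesis using column_cases[OF y] by blast
  qed (simp add: rank1_zero_left map_zero op_apply)
  have decompose: "cinner (y - cinner y x *\<^sub>C x) x = 0" "y = cinner y x *\<^sub>C x + (y - cinner y x *\<^sub>C x)" for y
    by (simp_all add: cinner_simps xx)
  define U where "U y = cblinfun_apply (\<Phi> (rank1 y x)) u" for y
  have U_add: "U (y + z) = U y + U z" and U_scale: "U (c *\<^sub>C y) = c *\<^sub>C U y" for y z c
    by (simp_all add: U_def rank1_add_left rank1_scaleC_left map_add map_scale op_apply)
  have Ux: "U x = u" by (simp add: U_def base rank1_apply uv scaleC_one)
  have \<Phi>column: "cblinfun_apply (\<Phi> (rank1 y x)) w = cinner w v *\<^sub>C U y" for y w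
  proof -
    define y' where "y' = y - cinner y x *\<^sub>C x"
    have y': "cinner y' x = 0" "y = cinner y x *\<^sub>C x + y'" unfolding y'_def by (rule decompose)+
    have "cblinfun_apply (\<Phi> (rank1 y' x)) w = cinner w v *\<^sub>C U y'"
      using column_split[OF y'(1), of w] column[OF y'(1), of w] by (simp add: U_def)
    then show ?thesis
      by (subst (1 2) y'(2))
        (simp add: rank1_add_left rank1_scaleC_left map_add map_scale op_apply base rank1_apply
          U_add U_scale Ux scaleC_simps mult.commute)
  qed
  have \<Phi>row: "cblinfun_apply (\<Phi> (rank1 x z)) w = cinner (cblinfun_apply (\<Phi> (rank1 x z)) w) v *\<^sub>C u" for z w
  proof -
    define z' where "z' = z - cinner z x *\<^sub>C x"
    have z': "cinner z' x = 0" "z = cinner z x *\<^sub>C x + z'" unfolding z'_def by (rule decompose)+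
    have "cblinfun_apply (\<Phi> (rank1 x z')) w = cinner (cblinfun_apply (\<Phi> (rank1 x z')) w) v *\<^sub>C u"
      using row_split[OF z'(1), of w] row[OF z'(1)] by simp
    then obtain c where "cblinfun_apply (\<Phi> (rank1 x z')) w = c *\<^sub>C u" by blast
    then have "cblinfun_apply (\<Phi> (rank1 x z)) w = (cnj (cinner z x) * cinner w v + c) *\<^sub>C u"
      by (subst z'(2))
        (simp add: rank1_add_right rank1_scaleC_right map_add map_scale op_apply base rank1_apply
          scaleC_simps)
    then show ?thesis by (simp add: cinner_simps uv)
  qed
  have Uv: "cinner (U y) v = cinner y x" for y
    using corner[of "rank1 y x"] by (simp add: U_def rank1_apply cinner_simps xx)
  have \<Phi>rank1_u: "cblinfun_apply (\<Phi> (rank1 y z)) u = cinner x z *\<^sub>C U y" for y z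
  proof -
    define H where "H = \<Phi> (rank1 x z)"
    define c where "c = cinner (cblinfun_apply H (U y)) v"
    have Hu: "cinner (cblinfun_apply H u) v = cinner x z"
      using corner[of "rank1 x z"] by (simp add: H_def rank1_apply cinner_simps xx)
    have "rank1 y x \<circ>\<^sub>J rank1 x z = rank1 y z + cinner y z *\<^sub>C rank1 x x"
      by (simp add: jordan_product_def rank1_compose_rank1 xx scaleC_one)
    from arg_cong[OF this, of "\<lambda>A. cblinfun_apply (\<Phi> A) u"]
    have eq: "cinner x z *\<^sub>C U y + c *\<^sub>C u = cblinfun_apply (\<Phi> (rank1 y z)) u + cinner y z *\<^sub>C u"
      using \<Phi>row[of z "U y"]
      by (simp add: mult map_add map_scale op_apply \<Phi>column base rank1_apply uv scaleC_simps
          flip: H_def c_def)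
        (simp add: Hu)
    have "cinner (cblinfun_apply (\<Phi> (rank1 y z)) u) v = cinner x z * cinner y x"
      using corner[of "rank1 y z"] by (simp add: rank1_apply cinner_simps)
    with arg_cong[OF eq, of "\<lambda>w. cinner w v"] have "c = cinner y z"
      by (simp add: cinner_simps Uv uv)
    with eq show ?thesis by simp
  qed
  have intertwine: "cblinfun_apply (\<Phi> B) (U y) = U (cblinfun_apply B y)" for B y
  proof -
    have "B \<circ>\<^sub>J rank1 y x = rank1 (cblinfun_apply B y) x + rank1 y (cblinfun_apply (cadjoint B) x)"
      by (simp add: jordan_product_def compose_rank1 rank1_compose)
    from arg_cong[OF this, of "\<lambda>A. cblinfun_apply (\<Phi> A) u"] show ?thesis
      by (simp add: mult map_add op_apply \<Phi>column uv scaleC_one \<Phi>rank1_u corner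
          cinner_adjoint_right xx)
  qed
  have "inj U"
  proof (rule injI)
    fix y z assume "U y = U z"
    then have "rank1 y x = rank1 z x"
      using bij by (metis \<Phi>column bij_is_inj cblinfun_eqI injD)
    from arg_cong[OF this, of "\<lambda>A. cblinfun_apply A x"] show "y = z"
      by (simp add: rank1_apply xx scaleC_one)
  qed
  have surj: "\<exists>y. U y = w" for w
  proof -
    obtain B where B: "\<Phi> B = rank1 w v" using bij by (metis bij_pointE)
    have "U (cblinfun_apply B x) = w"
      using intertwine[of B x] by (simp add: B Ux rank1_apply uv scaleC_one)
    then show ?thesis by blast
  qed
  define V where "V = inv U"
  have VU: "V (U y) = y" for y using \<open>inj U\<close> by (simp add: V_def)
  have UV: "U (V w) = w" for w using surj[of w] by (auto simp: VU)
  have V_add: "V (y + z) = V y + V z" and V_scale: "V (c *\<^sub>C y) = c *\<^sub>C V y" for y z c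
    by (rule injD[OF \<open>inj U\<close>], simp add: UV U_add U_scale)+
  have "\<exists>K. \<forall>y. norm (U y) \<le> K * norm y"
  proof (rule weakly_bounded_imp_bounded)
    fix q
    obtain B where B: "\<Phi> B = rank1 u q" using bij by (metis bij_pointE)
    have "U (cblinfun_apply B y) = U (cinner (U y) q *\<^sub>C x)" for y
      using intertwine[of B y] by (simp add: B rank1_apply U_scale Ux)
    then have "cblinfun_apply B y = cinner (U y) q *\<^sub>C x" for y using \<open>inj U\<close> by (metis injD)
    then have "norm (cblinfun_apply B y) = cmod (cinner (U y) q)" for y by (simp add: norm_scaleC x)
    then show "\<exists>K. \<forall>y. cmod (cinner (U y) q) \<le> K * norm y" using cblinfun_bound[of B] by auto
  qed
  then obtain K where K: "\<And>y. norm (U y) \<le> K * norm y" by blast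
  have "\<exists>L. \<forall>w. norm (V w) \<le> L * norm w"
  proof (rule weakly_bounded_imp_bounded)
    fix q
    define B where "B = \<Phi> (rank1 x q)"
    have B: "cblinfun_apply B w = cinner (V w) q *\<^sub>C u" for w
      using intertwine[of "rank1 x q" "V w"] by (simp add: B_def UV rank1_apply U_scale Ux)
    obtain M where M: "\<And>w. norm (cblinfun_apply B w) \<le> M * norm w" using cblinfun_bound by blast
    have "cmod (cinner (V w) q) \<le> (M / norm u) * norm w" for w
      using M[of w] u_nonzero by (simp add: B norm_scaleC field_simps)
    then show "\<exists>K. \<forall>w. cmod (cinner (V w) q) \<le> K * norm w" by blast
  qed
  then obtain L where L: "\<And>w. norm (V w) \<le> L * norm w" by blast
  have "bounded_clinear U" by (rule bounded_clinearI[OF U_add U_scale K])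
  moreover have "bounded_clinear V" by (rule bounded_clinearI[OF V_add V_scale L])
  ultimately have ap: "cblinfun_apply (CBlinfun U) y = U y" "cblinfun_apply (CBlinfun V) w = V w" for y w
    by (simp_all add: CBlinfun_apply)
  have "CBlinfun V o\<^sub>C CBlinfun U = cblinfun_id" "CBlinfun U o\<^sub>C CBlinfun V = cblinfun_id"
    by (rule cblinfun_eqI; simp add: op_apply ap VU UV)+
  moreover have "\<Phi> A = CBlinfun U o\<^sub>C A o\<^sub>C CBlinfun V" for A
    by (rule cblinfun_eqI) (metis ap UV intertwine cblinfun_compose.rep_eq)
  ultimately show ?thesis by blast
qed

end

section \<open>The transpose relative to an orthonormal basis\<close>

locale onb =
  fixes e :: "'i \<Rightarrow> 'a::chilbert_space"
  assumes basis: "orthonormal_basis e"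
begin

lemma cinner_basis: "cinner (e i) (e j) = (if i = j then 1 else 0)"
  using basis unfolding orthonormal_basis_def by blast

lemma basis_sequence:
  obtains X where "\<And>n. X n \<in> cspan (range e)" "X \<longlonglongrightarrow> x"
  using basis unfolding orthonormal_basis_def by (metis UNIV_I closure_sequential)

lemma eq_0_if_coefficients_0:
  assumes "\<And>i. cinner x (e i) = 0"
  shows "x = 0"
proof -
  have span: "cinner x y = 0" if "y \<in> cspan (range e)" for y
    using that
    by (induction rule: complex_vector.span_induct_alt) (auto simp: cinner_simps assms)
  obtain X where X: "\<And>n. X n \<in> cspan (range e)" "X \<longlonglongrightarrow> x" using basis_sequence[of x] by metis
  have "(\<lambda>n. cinner x (X n)) \<longlonglongrightarrow> cinner x x" by (rule tendsto_cinner_right[OF X(2)])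
  then show ?thesis using span[OF X(1)] by (simp add: LIMSEQ_const_iff)
qed

lemma eq_if_coefficients_eq: "(\<And>i. cinner x (e i) = cinner y (e i)) \<Longrightarrow> x = y"
  using eq_0_if_coefficients_0[of "x - y"] by (simp add: cinner_simps)

lemma operator_eq_if_basis_eq:
  assumes "\<And>i. cblinfun_apply A (e i) = cblinfun_apply B (e i)"
  shows "A = B"
proof (rule cblinfun_eqI)
  fix x
  have "cinner (cblinfun_apply (A - B) x) y = 0" for y
  proof -
    have "cblinfun_apply (cadjoint (A - B)) y = 0"
      by (rule eq_0_if_coefficients_0) (simp add: cinner_adjoint_left op_apply assms)
    then show ?thesis by (simp flip: cinner_adjoint_right)
  qed
  then have "cblinfun_apply (A - B) x = 0" by (metis cinner_self_eq_0_iff)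
  then show "cblinfun_apply A x = cblinfun_apply B x" by (simp add: op_apply)
qed

definition conjugates :: "'a \<Rightarrow> 'a \<Rightarrow> bool"
  where "conjugates x z \<longleftrightarrow> (\<forall>i. cinner z (e i) = cnj (cinner x (e i)))"

lemma conjugates_basis: "conjugates (e i) (e i)"
  by (simp add: conjugates_def cinner_basis)

lemma conjugate_exists:
  "\<exists>z. \<forall>x' z'. conjugates x' z' \<longrightarrow> cinner z z' = cnj (cinner x x')" (is "\<exists>z. ?P x z")
proof -
  have rel: "conjugates x z" if "?P x z" for x z
    unfolding conjugates_def using that conjugates_basis by blast
  have span: "\<exists>z. ?P x z" if "x \<in> cspan (range e)" for x
    using that
  proof (induction rule: complex_vector.span_induct_alt)
    case base
    show ?case by (intro exI[of _ 0]) simp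
  next
    case (step c b y)
    then obtain i z where i: "b = e i" and z: "?P y z" by blast
    have ei: "cinner (e i) z' = cnj (cinner (e i) x')" if "conjugates x' z'" for x' z'
      using that unfolding conjugates_def by (metis cinner_commute)
    show ?case
      by (intro exI[of _ "cnj c *\<^sub>C e i + z"]) (simp add: i cinner_simps ei z)
  qed
  obtain X where X: "\<And>n. X n \<in> cspan (range e)" "X \<longlonglongrightarrow> x" using basis_sequence[of x] by metis
  obtain Y where Y: "\<And>n. ?P (X n) (Y n)" using span[OF X(1)] by metis
  have "norm (Y m - Y n) = norm (X m - X n)" for m n
  proof -
    have "cinner (Y i) (Y j) = cnj (cinner (X i) (X j))" for i j using Y rel[OF Y] by blast
    then have "cinner (Y m - Y n) (Y m - Y n) = cnj (cinner (X m - X n) (X m - X n))"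
      by (simp add: cinner_simps)
    then have "complex_of_real ((norm (Y m - Y n))\<^sup>2) = complex_of_real ((norm (X m - X n))\<^sup>2)"
      by (simp only: cinner_self complex_cnj_complex_of_real)
    then have "(norm (Y m - Y n))\<^sup>2 = (norm (X m - X n))\<^sup>2" by (simp only: of_real_eq_iff)
    then show ?thesis by (rule power2_eq_imp_eq) simp_all
  qed
  moreover have "Cauchy X" using X(2) by (rule LIMSEQ_imp_Cauchy)
  ultimately have "Cauchy Y" by (simp add: Cauchy_def dist_norm)
  then obtain z where z: "Y \<longlonglongrightarrow> z" by (metis Cauchy_convergent convergent_def)
  have "cinner z z' = cnj (cinner x x')" if "conjugates x' z'" for x' z'
  proof -
    have "(\<lambda>n. cinner (Y n) z') \<longlonglongrightarrow> cinner z z'" by (rule tendsto_cinner_left[OF z])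
    moreover have "(\<lambda>n. cinner (Y n) z') \<longlonglongrightarrow> cnj (cinner x x')"
      using tendsto_cnj[OF tendsto_cinner_left[OF X(2)]] Y that by simp
    ultimately show ?thesis by (rule LIMSEQ_unique)
  qed
  then show ?thesis by blast
qed

definition conj :: "'a \<Rightarrow> 'a"
  where "conj x = (SOME z. \<forall>x' z'. conjugates x' z' \<longrightarrow> cinner z z' = cnj (cinner x x'))"

lemma cinner_conj_if_conjugates: "conjugates x' z' \<Longrightarrow> cinner (conj x) z' = cnj (cinner x x')"
  unfolding conj_def using someI_ex[OF conjugate_exists[of x]] by blast

lemma cinner_conj_basis: "cinner (conj x) (e i) = cnj (cinner x (e i))"
  by (rule cinner_conj_if_conjugates[OF conjugates_basis])

lemma cinner_conj_conj: "cinner (conj x) (conj y) = cnj (cinner x y)"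
  by (rule cinner_conj_if_conjugates) (simp add: conjugates_def cinner_conj_basis)

lemma conj_add: "conj (x + y) = conj x + conj y"
  by (rule eq_if_coefficients_eq) (simp add: cinner_conj_basis cinner_simps)

lemma conj_scaleC: "conj (c *\<^sub>C x) = cnj c *\<^sub>C conj x"
  by (rule eq_if_coefficients_eq) (simp add: cinner_conj_basis cinner_simps)

lemma conj_conj [simp]: "conj (conj x) = x"
  by (rule eq_if_coefficients_eq) (simp add: cinner_conj_basis)

lemma conj_basis: "conj (e i) = e i"
  by (rule eq_if_coefficients_eq) (simp add: cinner_conj_basis cinner_basis)

lemma cinner_conj_left: "cinner (conj x) y = cnj (cinner x (conj y))"
  using cinner_conj_conj[of x "conj y"] by simp

lemma cinner_conj_swap: "cinner (conj x) y = cinner (conj y) x"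
  using cinner_conj_left cinner_commute by metis

lemma cinner_conj_swap_right: "cinner x (conj y) = cinner y (conj x)"
  using cinner_conj_swap cinner_commute by metis

lemma norm_conj: "norm (conj x) = norm x"
proof -
  have "complex_of_real ((norm (conj x))\<^sup>2) = complex_of_real ((norm x)\<^sup>2)"
    using cinner_conj_conj[of x x] by (simp only: cinner_self complex_cnj_complex_of_real)
  then have "(norm (conj x))\<^sup>2 = (norm x)\<^sup>2" by (simp only: of_real_eq_iff)
  then show ?thesis by (rule power2_eq_imp_eq) simp_all
qed

lemma transpose_apply:
  "cblinfun_apply (op_transpose e A) x = conj (cblinfun_apply (cadjoint A) (conj x))"
proof -
  obtain K where K: "\<And>x. norm (cblinfun_apply (cadjoint A) x) \<le> K * norm x"
    using cblinfun_bound by blast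
  have "bounded_clinear (\<lambda>x. conj (cblinfun_apply (cadjoint A) (conj x)))"
  proof (rule bounded_clinearI)
    show "norm (conj (cblinfun_apply (cadjoint A) (conj x))) \<le> K * norm x" for x
      using K[of "conj x"] by (simp add: norm_conj)
  qed (simp_all add: conj_add conj_scaleC op_apply)
  then have B: "cblinfun_apply (CBlinfun (\<lambda>x. conj (cblinfun_apply (cadjoint A) (conj x)))) x
      = conj (cblinfun_apply (cadjoint A) (conj x))" for x
    by (rule CBlinfun_apply)
  have "op_transpose e A = CBlinfun (\<lambda>x. conj (cblinfun_apply (cadjoint A) (conj x)))"
    unfolding op_transpose_def
  proof (rule the_equality, intro allI)
    show "cinner (cblinfun_apply (CBlinfun (\<lambda>x. conj (cblinfun_apply (cadjoint A) (conj x)))) (e i)) (e j)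
        = cinner (cblinfun_apply A (e j)) (e i)" for i j
      unfolding B cinner_conj_swap[of _ "e j"] by (simp add: conj_basis cinner_adjoint_right)
    then show "C = CBlinfun (\<lambda>x. conj (cblinfun_apply (cadjoint A) (conj x)))"
      if "\<forall>i j. cinner (cblinfun_apply C (e i)) (e j) = cinner (cblinfun_apply A (e j)) (e i)" for C
      using that by (intro operator_eq_if_basis_eq eq_if_coefficients_eq) simp
  qed
  then show ?thesis by (simp add: B)
qed

lemma cinner_transpose_left:
  "cinner (cblinfun_apply (op_transpose e A) x) y = cinner (cblinfun_apply A (conj y)) (conj x)"
  unfolding transpose_apply cinner_conj_swap[of _ y] by (rule cinner_adjoint_right)

lemma transpose_transpose: "op_transpose e (op_transpose e A) = A"
  and transpose_add: "op_transpose e (A + B) = op_transpose e A + op_transpose e B"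
  and transpose_scaleC: "op_transpose e (c *\<^sub>C A) = c *\<^sub>C op_transpose e A"
  and transpose_id: "op_transpose e cblinfun_id = cblinfun_id"
  by (rule cblinfun_eq_cinnerI;
      simp add: cinner_transpose_left op_apply cinner_simps cinner_conj_conj flip: cinner_commute)+

lemma transpose_compose: "op_transpose e (A o\<^sub>C B) = op_transpose e B o\<^sub>C op_transpose e A"
proof (rule cblinfun_eq_cinnerI)
  fix x y
  have "cinner (cblinfun_apply (op_transpose e B o\<^sub>C op_transpose e A) x) y
      = cinner (cblinfun_apply B (conj y)) (cblinfun_apply (cadjoint A) (conj x))"
    by (simp add: op_apply cinner_transpose_left) (simp add: transpose_apply)
  then show "cinner (cblinfun_apply (op_transpose e (A o\<^sub>C B)) x) y
      = cinner (cblinfun_apply (op_transpose e B o\<^sub>C op_transpose e A) x) y"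
    by (simp add: cinner_transpose_left op_apply cinner_adjoint_right)
qed

lemma transpose_jordan: "op_transpose e (A \<circ>\<^sub>J B) = op_transpose e A \<circ>\<^sub>J op_transpose e B"
  by (simp add: jordan_product_def transpose_add transpose_compose add.commute)

lemma transpose_rank1: "op_transpose e (rank1 x y) = rank1 (conj y) (conj x)"
proof (rule cblinfun_eq_cinnerI)
  fix w z
  have "cinner (conj z) y * cinner x (conj w) = cinner w (conj x) * cinner (conj y) z"
    using cinner_conj_swap[of z y] cinner_conj_swap_right[of x w] by simp
  then show "cinner (cblinfun_apply (op_transpose e (rank1 x y)) w) z
      = cinner (cblinfun_apply (rank1 (conj y) (conj x)) w) z"
    by (simp add: cinner_transpose_left rank1_apply cinner_simps)
qed

lemma transpose_finite_rank: "F \<in> finite_rank \<Longrightarrow> op_transpose e F \<in> finite_rank"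
proof (induction rule: finite_rank_induct)
  case zero
  have "op_transpose e 0 = 0" using transpose_add[of 0 0] by simp
  then show ?case by (simp add: finite_rank_zero)
qed (simp_all add: transpose_add transpose_scaleC transpose_rank1 finite_rank_add finite_rank_scaleC)

end

section \<open>Spatial implementation\<close>

lemma unital_jordan_map_spatial:
  fixes \<Phi> :: "('a::chilbert_space, 'a) cblinfun \<Rightarrow> ('b::chilbert_space, 'b) cblinfun"
  assumes \<Phi>: "unital_jordan_map \<Phi>" and e: "orthonormal_basis e" and x: "norm (x :: 'a) = 1"
  shows "\<exists>U U_inv. U_inv o\<^sub>C U = cblinfun_id \<and> U o\<^sub>C U_inv = cblinfun_id \<and>
    ((\<forall>A. \<Phi> A = U o\<^sub>C A o\<^sub>C U_inv) \<or> (\<forall>A. \<Phi> A = U o\<^sub>C op_transpose e A o\<^sub>C U_inv))"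
proof -
  interpret unital_jordan_map \<Phi> by fact
  interpret onb e by unfold_locales fact
  obtain u v where image: "\<Phi> (rank1 x x) = rank1 u v" "cinner u v = 1"
    using map_projection_rank1[OF x] by blast
  interpret based_jordan_map \<Phi> x u v by unfold_locales (fact x image)+
  show ?thesis
  proof (cases "\<forall>y. cinner y x = 0 \<longrightarrow> cblinfun_apply (\<Phi> (rank1 x y)) u = 0")
    case True
    then show ?thesis using spatial by blast
  next
    case False
    then have column0: "cblinfun_apply (\<Phi> (rank1 y x)) u = 0" if "cinner y x = 0" for y
      using dichotomy that by blast
    have t: "bij (op_transpose e)" by (rule involuntory_imp_bij) (rule transpose_transpose)
    interpret T: based_jordan_map "\<lambda>A. \<Phi> (op_transpose e A)" "conj x" u v
    proof
      show "bij (\<lambda>A. \<Phi> (op_transpose e A))" using bij_comp[OF t bij] by (simp add: comp_def)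
    qed (simp_all add: transpose_add transpose_scaleC transpose_id map_add map_scale map_id
        transpose_jordan mult transpose_finite_rank norm_conj x transpose_rank1 image)
    have "cblinfun_apply (\<Phi> (op_transpose e (rank1 (conj x) y))) u = 0" if "cinner y (conj x) = 0" for y
      using column0[of "conj y"] that by (simp add: transpose_rank1 cinner_conj_left)
    from T.spatial[OF this] obtain U U_inv where
      U: "U_inv o\<^sub>C U = cblinfun_id" "U o\<^sub>C U_inv = cblinfun_id"
      and \<Phi>T: "\<And>A. \<Phi> (op_transpose e A) = U o\<^sub>C A o\<^sub>C U_inv" by blast
    have "\<Phi> A = U o\<^sub>C op_transpose e A o\<^sub>C U_inv" for A
      using \<Phi>T[of "op_transpose e A"] by (simp add: transpose_transpose)
    with U show ?thesis by blast
  qed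
qed

lemma orthogonal_vectors_exist:
  assumes "\<nexists>S :: 'a::complex_inner set. finite S \<and> cspan S = UNIV"
  shows "\<exists>x y :: 'a. norm x = 1 \<and> y \<noteq> 0 \<and> cinner x y = 0"
proof -
  have "cspan {} \<noteq> (UNIV :: 'a set)" using assms by blast
  then obtain w :: 'a where "w \<noteq> 0" by (auto simp: complex_vector.span_empty)
  then obtain c x where x: "norm x = 1" "w = c *\<^sub>C x" by (rule unit_multiple)
  have "cspan {x} \<noteq> UNIV" using assms by blast
  then obtain z where z: "z \<notin> cspan {x}" by blast
  define y where "y = z - cinner z x *\<^sub>C x"
  have "y \<noteq> 0"
  proof
    assume "y = 0"
    then have "z = cinner z x *\<^sub>C x" by (simp add: y_def)
    then have "z \<in> cspan {x}"
      by (metis complex_vector.span_base complex_vector.span_scale singletonI)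
    with z show False by blast
  qed
  moreover have "cinner y x = 0" by (simp add: y_def cinner_simps cinner_self x)
  ultimately show ?thesis using x cinner_eq_0_sym[of x y] by blast
qed

theorem theorem1p4:
  fixes \<Psi> :: "('a::chilbert_space, 'a) cblinfun \<Rightarrow> ('b::chilbert_space, 'b) cblinfun"
    and D\<^sub>1 :: "('a, 'a) cblinfun"
    and D\<^sub>2 :: "('b, 'b) cblinfun"
    and e :: "'i \<Rightarrow> 'a"
  assumes "\<nexists>S :: 'a set. finite S \<and> cspan S = UNIV"
    and "\<nexists>S :: 'b set. finite S \<and> cspan S = UNIV"
    and "clinear \<Psi>"
    and "bij \<Psi>"
    and "\<And>A\<^sub>1 A\<^sub>2. A\<^sub>1 \<circ>\<^sub>J A\<^sub>2 = D\<^sub>1 \<Longrightarrow> \<Psi> A\<^sub>1 \<circ>\<^sub>J \<Psi> A\<^sub>2 = D\<^sub>2"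
    and "orthonormal_basis e"
  shows "\<exists>(c :: complex) (U :: ('a, 'b) cblinfun) (U_inv :: ('b, 'a) cblinfun).
    c \<noteq> 0 \<and> U_inv o\<^sub>C U = cblinfun_id \<and> U o\<^sub>C U_inv = cblinfun_id \<and>
    ((\<forall>A. \<Psi> A = c *\<^sub>C (U o\<^sub>C A o\<^sub>C U_inv)) \<or>
     (\<forall>A. \<Psi> A = c *\<^sub>C (U o\<^sub>C op_transpose e A o\<^sub>C U_inv)))"
proof -
  have add: "\<Psi> (A + B) = \<Psi> A + \<Psi> B" and scale: "\<Psi> (c *\<^sub>C A) = c *\<^sub>C \<Psi> A" for A B c
    using assms(3) unfolding clinear_iff by blast+
  define Z where "Z = \<Psi> cblinfun_id"
  define \<Gamma> where "\<Gamma> A B = \<Psi> A \<circ>\<^sub>J \<Psi> B + \<Psi> A \<circ>\<^sub>J \<Psi> B - Z \<circ>\<^sub>J \<Psi> (A \<circ>\<^sub>J B)" for A B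
  have half: "(1/2 :: complex) *\<^sub>C (C + C) = C" for C :: "('c::complex_inner, 'c) cblinfun"
    by (simp add: scaleC_add_right scaleC_one flip: scaleC_add_left)
  have D\<^sub>2: "D\<^sub>2 + D\<^sub>2 = Z \<circ>\<^sub>J \<Psi> D\<^sub>1"
  proof -
    have "((1/2) *\<^sub>C cblinfun_id) \<circ>\<^sub>J D\<^sub>1 = D\<^sub>1" unfolding jordan_scaleC_left jordan_id_left by (rule half)
    from assms(5)[OF this] have "D\<^sub>2 = (1/2) *\<^sub>C (Z \<circ>\<^sub>J \<Psi> D\<^sub>1)" by (simp add: Z_def scale jordan_simps)
    then show ?thesis by (simp add: scaleC_one flip: scaleC_add_left)
  qed
  have \<Gamma>: "\<Gamma> B (rank1 y z) = 0" for B y z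
  proof (rule cblinfun_eq_cinnerI)
    fix p q
    interpret jordan_form "\<lambda>A B. cinner (cblinfun_apply (\<Gamma> A B) p) q" D\<^sub>1
    proof
      show "A \<circ>\<^sub>J B = D\<^sub>1 \<Longrightarrow> cinner (cblinfun_apply (\<Gamma> A B) p) q = 0" for A B
        by (simp add: \<Gamma>_def assms(5) D\<^sub>2 op_apply)
      show "cinner (cblinfun_apply (\<Gamma> A B) p) q = cinner (cblinfun_apply (\<Gamma> B A) p) q" for A B
        by (simp add: \<Gamma>_def jordan_commute[of A B] jordan_commute[of "\<Psi> A"])
      show "cinner (cblinfun_apply (\<Gamma> cblinfun_id A) p) q = 0" for A
        by (simp add: \<Gamma>_def jordan_id_left add jordan_add_right op_apply flip: Z_def)
    qed (simp_all add: \<Gamma>_def add scale jordan_simps op_apply cinner_simps algebra_simps)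
    show "cinner (cblinfun_apply (\<Gamma> B (rank1 y z)) p) q = cinner (cblinfun_apply 0 p) q"
      using form_rank1[of B y z] by (simp add: op_apply)
  qed
  interpret S: scaled_jordan_map \<Psi> Z
    by unfold_locales (use \<Gamma> in \<open>simp_all add: add scale assms(4) Z_def \<Gamma>_def\<close>)
  obtain x y :: 'a where x: "norm x = 1" and xy: "y \<noteq> 0" "cinner x y = 0"
    using orthogonal_vectors_exist[OF assms(1)] by blast
  have "x \<noteq> 0" using x by auto
  from S.scalar[OF this xy] obtain c where c: "c \<noteq> 0" "Z = c *\<^sub>C cblinfun_id" by blast
  define \<Phi> where "\<Phi> A = (1/c) *\<^sub>C \<Psi> A" for A
  have \<Psi>\<Phi>: "\<Psi> A = c *\<^sub>C \<Phi> A" for A using c by (simp add: \<Phi>_def scaleC_simps)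
  have "unital_jordan_map \<Phi>"
  proof
    show "\<Phi> (A + B) = \<Phi> A + \<Phi> B" for A B by (simp add: \<Phi>_def add scaleC_add_right)
    show "\<Phi> (k *\<^sub>C A) = k *\<^sub>C \<Phi> A" for k A by (simp add: \<Phi>_def scale scaleC_simps)
    have "bij (\<lambda>A :: ('b, 'b) cblinfun. (1/c) *\<^sub>C A)"
      by (rule o_bij[where g = "\<lambda>A. c *\<^sub>C A"]) (use c in \<open>auto simp: fun_eq_iff scaleC_simps\<close>)
    from bij_comp[OF assms(4) this] show "bij \<Phi>" by (simp add: comp_def \<Phi>_def[abs_def])
    show "\<Phi> cblinfun_id = cblinfun_id" using c by (simp add: \<Phi>_def scaleC_simps flip: Z_def)
    fix B F :: "('a, 'a) cblinfun"
    assume "F \<in> finite_rank"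
    from S.mult[OF this, of B] have "\<Psi> B \<circ>\<^sub>J \<Psi> F = c *\<^sub>C \<Psi> (B \<circ>\<^sub>J F)"
      unfolding c(2) jordan_scaleC_left jordan_id_left scaleC_add_right by (rule add_self_cancel)
    then show "\<Phi> (B \<circ>\<^sub>J F) = \<Phi> B \<circ>\<^sub>J \<Phi> F"
      using c by (simp add: \<Phi>_def jordan_simps scaleC_simps)
  qed
  from unital_jordan_map_spatial[OF this assms(6) x] show ?thesis
    unfolding \<Psi>\<Phi> using c(1) by metis
qed

end
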